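(* Let $G$ be a second countable locally compact Hausdorff group acting continuously and properly on a (second countable, Hausdorff) locally compact space $S$, let $m$ be a $G$-invariant Borel measure on $S$, and let $P$ be a $G$-invariant Markov operator on $S$ with absolutely continuous transition probabilities and continuous densities with respect to $m$. Suppose that $G$ also acts continuously on another (second countable, Hausdorff) locally compact space $X$, and that there is a continuous $G$-equivariant map assigning to points $x\in X$ projective classes of minimal positive $P$-harmonic functions $\varphi_x$ on $S$. Then the action of $G$ on $X$ is topologically amenable.
   Context: $\mathcal{P}(G)$ denotes the space of Borel probability measures on $G$; $\|\cdot\|$ is the total variation norm. Topologically amenable action. A continuous action of a locally compact group $G$ on a locally compact space $X$ is topologically amenable if there is a sequence of weak$^*$ continuous maps $\theta_n:X\to\mathcal{P}(G)$ such that $\|g\theta_n(x)-\theta_n(gx)\|\to0$ uniformly on compact subsets of $G\times X$. Markov operators. $P$ is given by a Borel family $\{\pi_s\}_{s\in S}$ of probability measures on $S$ via $Pf(s)=\int f\,d\pi_s$; it is $G$-invariant if $\pi_{gs}=g\pi_s$ for all $g\in G$, $s\in S$. The assumption on transition probabilities means $d\pi_s(t)=p(s,t)\,dm(t)$ with $p$ continuous on $S\times S$. A (strictly) positive function $\varphi$ on $S$ is $P$-harmonic if $P\varphi=\varphi$, and it is minimal if every $P$-harmonic function $\psi$ with $0\le\psi\le\varphi$ is a constant multiple of $\varphi$. The projective class of $\varphi$ is the set of its positive multiples; it is determined by the function $(s,t)\mapsto\varphi(t)/\varphi(s)$. The map $x\mapsto[\varphi_x]$ is continuous if $(x,s,t)\mapsto\varphi_x(t)/\varphi_x(s)$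 is continuous on $X\times S\times S$, and $G$-equivariant if for every $g\in G$ and $x\in X$ the function $\varphi_{gx}$ is proportional to $s\mapsto\varphi_x(g^{-1}s)$. *)

theory Defs
  imports "HOL-Probability.Probability"
begin

text \<open>
  Groups are written additively, because this is how the type classes for topological groups
  are set up; \<^class>\<open>topological_group_add\<close> does not include commutativity.
  All measures live on Borel sigma-algebras, so \<open>space (prob_algebra borel)\<close> is the set of
  all Borel probability measures.
\<close>

section \<open>Group actions\<close>

definition continuous_action ::
    "('g::topological_group_add \<Rightarrow> 'x::topological_space \<Rightarrow> 'x) \<Rightarrow> bool" where
  "continuous_action act \<longleftrightarrow>
     (\<forall>x. act 0 x = x) \<and>
     (\<forall>g h x. act (g + h) x = act g (act h x)) \<and>
     continuous_on UNIV (\<lambda>(g, x). act g x)"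

definition proper_action ::
    "('g::topological_group_add \<Rightarrow> 'x::topological_space \<Rightarrow> 'x) \<Rightarrow> bool" where
  "proper_action act \<longleftrightarrow> proper_map euclidean euclidean (\<lambda>(g, x). (act g x, x))"

definition invariant_measure ::
    "('g \<Rightarrow> 's \<Rightarrow> 's) \<Rightarrow> 's::topological_space measure \<Rightarrow> bool" where
  "invariant_measure act m \<longleftrightarrow> (\<forall>g. distr m borel (act g) = m)"

section \<open>Topological amenability\<close>

definition vanishes_at_infinity :: "('a::topological_space \<Rightarrow> real) \<Rightarrow> bool" where
  "vanishes_at_infinity f \<longleftrightarrow> (\<forall>\<epsilon>>0. compact {x. \<epsilon> \<le> \<bar>f x\<bar>})"

text \<open>
  The weak* topology is the one the Borel probability measures inherit from the dual of the
  space of continuous functions vanishing at infinity, that is, the initial topology for the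
  functionals \<open>\<lambda>\<mu>. \<integral>h. f h \<partial>\<mu>\<close>.
\<close>

definition weak_star_continuous ::
    "('x::topological_space \<Rightarrow> 'g::topological_space measure) \<Rightarrow> bool" where
  "weak_star_continuous \<theta> \<longleftrightarrow>
     (\<forall>f::'g \<Rightarrow> real. continuous_on UNIV f \<and> vanishes_at_infinity f \<longrightarrow>
        continuous_on UNIV (\<lambda>x. \<integral>h. f h \<partial>(\<theta> x)))"

text \<open>
  The total variation norm of a signed Borel measure, given as a set function: the supremum is
  over the finite partitions of the space into Borel sets. It is a supremum in the reals, hence
  meaningful only for bounded variation, as for differences of probability measures.
\<close>

definition tv_norm :: "('a::topological_space set \<Rightarrow> real) \<Rightarrow> real" where
  "tv_norm \<nu> =
     (SUP \<P>\<in>{\<P>. finite \<P> \<and> \<P> \<subseteq> sets borel \<and> partition_on UNIV \<P>}. \<Sum>A\<in>\<P>. \<bar>\<nu> A\<bar>)"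

definition topologically_amenable ::
    "('g::topological_group_add \<Rightarrow> 'x::topological_space \<Rightarrow> 'x) \<Rightarrow> bool" where
  "topologically_amenable act \<longleftrightarrow>
     (\<exists>\<theta> :: nat \<Rightarrow> 'x \<Rightarrow> 'g measure.
        (\<forall>n x. \<theta> n x \<in> space (prob_algebra borel)) \<and>
        (\<forall>n. weak_star_continuous (\<theta> n)) \<and>
        (\<forall>K. compact K \<longrightarrow>
           uniform_limit K
             (\<lambda>n (g, x). tv_norm (\<lambda>A. measure (distr (\<theta> n x) borel ((+) g)) A
                                      - measure (\<theta> n (act g x)) A))
             (\<lambda>_. 0) sequentially))"

section \<open>Markov operators and harmonic functions\<close>

definition markov_operator :: "('s \<Rightarrow> 's measure) \<Rightarrow> ('s \<Rightarrow> real) \<Rightarrow> 's \<Rightarrow> real" where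
  "markov_operator \<pi> f s = (\<integral>t. f t \<partial>(\<pi> s))"

definition invariant_kernel ::
    "('g \<Rightarrow> 's \<Rightarrow> 's) \<Rightarrow> ('s::topological_space \<Rightarrow> 's measure) \<Rightarrow> bool" where
  "invariant_kernel act \<pi> \<longleftrightarrow> (\<forall>g s. \<pi> (act g s) = distr (\<pi> s) borel (act g))"

text \<open>
  Integrability is required explicitly, since the Bochner integral of a non-integrable function
  is 0 by convention.
\<close>

definition harmonic ::
    "('s::topological_space \<Rightarrow> 's measure) \<Rightarrow> ('s \<Rightarrow> real) \<Rightarrow> bool" where
  "harmonic \<pi> f \<longleftrightarrow>
     f \<in> borel_measurable borel \<and> (\<forall>s. integrable (\<pi> s) f) \<and> markov_operator \<pi> f = f"

definition minimal_positive_harmonic ::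
    "('s::topological_space \<Rightarrow> 's measure) \<Rightarrow> ('s \<Rightarrow> real) \<Rightarrow> bool" where
  "minimal_positive_harmonic \<pi> \<phi> \<longleftrightarrow>
     harmonic \<pi> \<phi> \<and> (\<forall>s. 0 < \<phi> s) \<and>
     (\<forall>\<psi>. harmonic \<pi> \<psi> \<and> (\<forall>s. 0 \<le> \<psi> s \<and> \<psi> s \<le> \<phi> s) \<longrightarrow> (\<exists>c. \<forall>s. \<psi> s = c * \<phi> s))"

text \<open>
  A map into projective classes is given by representatives \<open>\<phi> x\<close>; both properties below are
  unchanged when each \<open>\<phi> x\<close> is replaced by a positive multiple depending on \<open>x\<close>.
\<close>

definition projectively_continuous ::
    "('x::topological_space \<Rightarrow> 's::topological_space \<Rightarrow> real) \<Rightarrow> bool" where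
  "projectively_continuous \<phi> \<longleftrightarrow> continuous_on UNIV (\<lambda>(x, s, t). \<phi> x t / \<phi> x s)"

definition projectively_equivariant ::
    "('g::group_add \<Rightarrow> 's \<Rightarrow> 's) \<Rightarrow> ('g \<Rightarrow> 'x \<Rightarrow> 'x) \<Rightarrow> ('x \<Rightarrow> 's \<Rightarrow> real) \<Rightarrow> bool" where
  "projectively_equivariant actS actX \<phi> \<longleftrightarrow>
     (\<forall>g x. \<exists>c. \<forall>s. \<phi> (actX g x) s = c * \<phi> x (actS (- g) s))"

end

theory Submission
  imports Defs
begin

text \<open>
  The ratio \<open>\<phi> x t / \<phi> x s\<close> turns \<open>\<pi>\<close> into a Markov kernel, the Doob transform of \<open>\<pi>\<close> by
  \<open>\<phi> x\<close>, that depends only on the projective class of \<open>\<phi> x\<close>. A bounded harmonic function \<open>h\<close>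
  of the transform is the same thing as a harmonic function \<open>\<phi> x * h\<close> of \<open>\<pi>\<close> dominated by a
  multiple of \<open>\<phi> x\<close>, so minimality of \<open>\<phi> x\<close> says exactly that the transformed chain has the
  Liouville property (\<open>minimal_imp_liouville\<close>). Start the transformed chain at two points and
  average its distributions over the times \<open>1, \<dots>, n + 1\<close>. If the two averages stayed apart in
  total variation along some subsequence, a limit of the averages of the separating test
  functions would be a nonconstant bounded harmonic function. Hence they approach each other,
  uniformly for the two points and the parameter \<open>x\<close> in compact sets. The averages \<open>\<mu>\<^sub>n\<^sup>x\<close> started at a fixed point \<open>s\<^sub>0\<close>
  therefore form an asymptotically invariant sequence of maps from \<open>X\<close> to the probability measures
  on \<open>S\<close>: translating \<open>\<mu>\<^sub>n\<^sup>x\<close> by \<open>g\<close> gives the average for the parameter \<open>g x\<close> started at \<open>g s\<^sub>0\<close>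
  instead of \<open>s\<^sub>0\<close>.

  The compactness argument has to produce a limit that is harmonic at every point, not just almost
  everywhere, and has to do so while \<open>x\<close> moves. Both follow from continuity of the transformed
  kernel in total variation, jointly in \<open>x\<close> and \<open>s\<close>. By Scheffe's lemma this is where
  continuous densities enter (\<open>densities_converge_in_norm\<close>): bounded Borel functions are sent to an
  equicontinuous family, from which a pointwise convergent subsequence can be selected
  (\<open>P_convergent_subsequence\<close>, \<open>almost_harmonic_asymptotically_constant\<close>).

  It remains to move from \<open>S\<close> to \<open>G\<close>. Because the action on \<open>S\<close> is proper, there is a Borel map
  \<open>\<tau>\<close> from \<open>S\<close> to the probability measures on \<open>G\<close> that commutes with the action: take
  \<open>d\<tau>\<^sub>s(g) = c(g\<^sup>-\<^sup>1 s) dg / F(s)\<close> for a suitable weight \<open>c\<close> and the normalizing integral \<open>F\<close>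
  (\<open>exists_equivariant_kernel_of_proper_action\<close>). Integrating \<open>\<tau>\<close> against \<open>\<mu>\<^sub>n\<^sup>x\<close> does not increase
  total variation and gives the maps \<open>\<theta>\<^sub>n\<close>. These are weak* continuous although \<open>\<tau>\<close> is
  merely Borel, since \<open>\<mu>\<^sub>n\<^sup>x\<close> integrates every bounded Borel function to a
  continuous function of \<open>x\<close>.

  The formula for \<open>\<tau>\<close> uses a Haar measure, and this cannot be avoided: for a compact group acting
  on a point, asymptotically invariant probability measures converge to the Haar measure. It is
  obtained here from Weil's covering numbers: the normalized numbers of translates of a small
  neighbourhood that are needed to cover a compact set have a limit along a filter, the limit is
  a content on the compact sets, and the content induces a Borel measure by Caratheodory's
  construction (\<open>exists_left_invariant_measure\<close>).
\<close>

section \<open>Measures induced by contents on compact sets\<close>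

lemma Hausdorff_space_euclidean_t2: "Hausdorff_space (euclidean :: 'a::t2_space topology)"
  unfolding Hausdorff_space_def using hausdorff by (auto simp: disjnt_def)

text \<open>
  The parts of \<open>K\<close> outside \<open>U\<close> and outside \<open>V\<close> are disjoint compact sets; removing separating
  neighbourhoods of them from \<open>K\<close> gives the two pieces.
\<close>

lemma compact_subset_Un_split:
  fixes K :: "'a::t2_space set"
  assumes "compact K" "open U" "open V" "K \<subseteq> U \<union> V"
  obtains A B where "compact A" "compact B" "A \<subseteq> U" "B \<subseteq> V" "K = A \<union> B"
proof -
  have "compactin euclidean (K - U)" "compactin euclidean (K - V)" "disjnt (K - U) (K - V)"
    using assms by (auto simp: compact_diff disjnt_def)
  then obtain O1 O2 where O: "open O1" "open O2" "K - U \<subseteq> O1" "K - V \<subseteq> O2" "disjnt O1 O2"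
    using Hausdorff_space_compact_separation[OF Hausdorff_space_euclidean_t2]
    by (metis open_openin)
  show thesis
  proof
    show "compact (K - O1)" "compact (K - O2)" using O assms by (auto simp: compact_diff)
    show "K - O1 \<subseteq> U" "K - O2 \<subseteq> V" "K = K - O1 \<union> (K - O2)"
      using O by (auto simp: disjnt_def)
  qed
qed

text \<open>
  A content in the sense of Halmos. Disjoint compact sets are the only ones on which a limit of
  covering numbers is additive, because sufficiently small translates cannot meet both.
\<close>

locale compact_content =
  fixes l :: "'a::t2_space set \<Rightarrow> real"
  assumes nonneg: "compact K \<Longrightarrow> 0 \<le> l K"
    and mono: "compact K \<Longrightarrow> compact L \<Longrightarrow> K \<subseteq> L \<Longrightarrow> l K \<le> l L"
    and subadditive: "compact K \<Longrightarrow> compact L \<Longrightarrow> l (K \<union> L) \<le> l K + l L"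
    and additive: "compact K \<Longrightarrow> compact L \<Longrightarrow> K \<inter> L = {} \<Longrightarrow> l (K \<union> L) = l K + l L"
begin

lemma content_empty: "l {} = 0"
  using additive[of "{}" "{}"] by simp

definition inner_value :: "'a set \<Rightarrow> ennreal" where
  "inner_value U = (SUP K\<in>{K. compact K \<and> K \<subseteq> U}. ennreal (l K))"

text \<open>
  The value of an open set is approximated from inside by compact sets. Approximating from inside
  first is what makes open sets measurable for the resulting outer measure.
\<close>

definition outer_value :: "'a set \<Rightarrow> ennreal" where
  "outer_value E = (INF U\<in>{U. open U \<and> E \<subseteq> U}. inner_value U)"

definition induced_measure :: "'a measure" where
  "induced_measure = measure_of UNIV (sets borel) outer_value"

lemma le_inner_value: "compact K \<Longrightarrow> K \<subseteq> U \<Longrightarrow> ennreal (l K) \<le> inner_value U"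
  unfolding inner_value_def by (rule SUP_upper) auto

lemma inner_value_least:
  "(\<And>K. compact K \<Longrightarrow> K \<subseteq> U \<Longrightarrow> ennreal (l K) \<le> b) \<Longrightarrow> inner_value U \<le> b"
  unfolding inner_value_def by (rule SUP_least) auto

lemma outer_value_le: "open U \<Longrightarrow> E \<subseteq> U \<Longrightarrow> outer_value E \<le> inner_value U"
  unfolding outer_value_def by (rule INF_lower) auto

lemma outer_value_greatest:
  "(\<And>U. open U \<Longrightarrow> E \<subseteq> U \<Longrightarrow> b \<le> inner_value U) \<Longrightarrow> b \<le> outer_value E"
  unfolding outer_value_def by (rule INF_greatest) auto

lemma outer_value_mono: "E \<subseteq> F \<Longrightarrow> outer_value E \<le> outer_value F"
  by (rule outer_value_greatest) (auto intro: outer_value_le)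

lemma le_outer_value: "compact K \<Longrightarrow> ennreal (l K) \<le> outer_value K"
  by (rule outer_value_greatest) (rule le_inner_value)

lemma outer_value_empty: "outer_value {} = 0"
proof -
  have "outer_value {} \<le> inner_value {}" by (rule outer_value_le) auto
  also have "\<dots> \<le> 0" by (rule inner_value_least) (auto simp: content_empty)
  finally show ?thesis by simp
qed

text \<open>
  A compact subset of a finite union of open sets splits into compact subsets of its members, so
  subadditivity passes from compact to open sets. Countable unions follow by compactness.
\<close>

lemma content_le_sum_inner_value:
  assumes "finite I" "\<And>i. i \<in> I \<Longrightarrow> open (U i)" "compact K" "K \<subseteq> (\<Union>i\<in>I. U i)"
  shows "ennreal (l K) \<le> (\<Sum>i\<in>I. inner_value (U i))"
  using assms
proof (induction I arbitrary: K rule: finite_induct)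
  case empty
  then show ?case by (simp add: content_empty)
next
  case (insert i I)
  obtain A B where AB: "compact A" "compact B" "A \<subseteq> U i" "B \<subseteq> (\<Union>j\<in>I. U j)" "K = A \<union> B"
    by (rule compact_subset_Un_split[of K "U i" "\<Union>j\<in>I. U j"]) (use insert.prems in auto)
  have "ennreal (l K) \<le> ennreal (l A + l B)"
    using AB by (auto intro!: ennreal_leI subadditive)
  also have "\<dots> = ennreal (l A) + ennreal (l B)"
    using AB by (simp add: nonneg ennreal_plus)
  also have "\<dots> \<le> inner_value (U i) + (\<Sum>j\<in>I. inner_value (U j))"
    using AB insert.prems by (intro add_mono le_inner_value insert.IH) auto
  finally show ?case using insert.hyps by simp
qed

lemma inner_value_UN_le:
  assumes "\<And>i::nat. open (U i)"
  shows "inner_value (\<Union>i. U i) \<le> (\<Sum>i. inner_value (U i))"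
proof (rule inner_value_least)
  fix K assume K: "compact K" "K \<subseteq> (\<Union>i. U i)"
  obtain I where I: "finite I" "K \<subseteq> (\<Union>i\<in>I. U i)"
    by (rule compactE_image[OF K(1), of UNIV U]) (use K assms in auto)
  have "ennreal (l K) \<le> (\<Sum>i\<in>I. inner_value (U i))"
    by (rule content_le_sum_inner_value) (use I K assms in auto)
  also have "\<dots> \<le> (\<Sum>i. inner_value (U i))"
    by (rule sum_le_suminf) (use I in auto)
  finally show "ennreal (l K) \<le> (\<Sum>i. inner_value (U i))" .
qed

text \<open>
  Choosing an open superset of the \<open>i\<close>-th set up to an error \<open>\<epsilon> / 2 ^ (i + 1)\<close> reduces the claim
  to open sets.
\<close>

lemma outer_value_UN_le:
  "outer_value (\<Union>i. E i) \<le> (\<Sum>i::nat. outer_value (E i))"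
proof (rule ennreal_le_epsilon)
  fix e :: real assume fin: "(\<Sum>i. outer_value (E i)) < top" and "0 < e"
  have "\<exists>U. open U \<and> E i \<subseteq> U \<and> inner_value U \<le> outer_value (E i) + ennreal (e * (1/2) ^ Suc i)" for i
  proof -
    have "outer_value (E i) < top"
      using fin by (meson ennreal_suminf_lessD)
    then have "outer_value (E i) < outer_value (E i) + ennreal (e * (1/2) ^ Suc i)"
      using \<open>0 < e\<close> by (auto simp: ennreal_less_zero_iff less_top intro!: ennreal_add_left_cancel_less[THEN iffD2, of _ 0, simplified])
    then show ?thesis
      unfolding outer_value_def INF_less_iff by (fastforce intro: less_imp_le)
  qed
  then obtain U where U: "\<And>i. open (U i)" "\<And>i. E i \<subseteq> U i"
      "\<And>i. inner_value (U i) \<le> outer_value (E i) + ennreal (e * (1/2) ^ Suc i)" by metis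
  have "outer_value (\<Union>i. E i) \<le> inner_value (\<Union>i. U i)"
    by (rule outer_value_le) (use U in auto)
  also have "\<dots> \<le> (\<Sum>i. inner_value (U i))" by (rule inner_value_UN_le) (use U in auto)
  also have "\<dots> \<le> (\<Sum>i. outer_value (E i) + ennreal (e * (1/2) ^ Suc i))"
    by (intro suminf_le U) auto
  also have "\<dots> = (\<Sum>i. outer_value (E i)) + (\<Sum>i. ennreal (e * (1/2) ^ Suc i))"
    by (rule suminf_add[symmetric]) auto
  also have "(\<Sum>i. ennreal (e * (1/2) ^ Suc i)) = ennreal e"
  proof (rule suminf_ennreal_eq)
    show "(\<lambda>i. e * (1/2) ^ Suc i) sums e"
      using sums_mult[OF power_half_series, of e] by simp
  qed (use \<open>0 < e\<close> in auto)
  finally show "outer_value (\<Union>i. E i) \<le> (\<Sum>i. outer_value (E i)) + ennreal e" .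
qed

lemma outer_measure_space_outer_value: "outer_measure_space UNIV outer_value"
  unfolding outer_measure_space_def positive_def increasing_def countably_subadditive_def
  by (auto simp: outer_value_empty intro: outer_value_mono outer_value_UN_le)

text \<open>
  Fill \<open>W \<inter> U\<close> with a compact set \<open>K\<close> first and then fill the open set \<open>W - K\<close>, which contains
  \<open>W - U\<close>, with a second compact set; the two are disjoint, so the content adds up.
\<close>

lemma inner_value_split_le:
  assumes "open U" "open W"
  shows "inner_value (W \<inter> U) + outer_value (W - U) \<le> inner_value W"
proof -
  have *: "ennreal (l K) + inner_value (W - K) \<le> inner_value W" if K: "compact K" "K \<subseteq> W \<inter> U" for K
  proof -
    have ne: "{L. compact L \<and> L \<subseteq> W - K} \<noteq> {}" by (auto intro!: exI[of _ "{}"])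
    have "ennreal (l K) + inner_value (W - K)
        = (SUP L\<in>{L. compact L \<and> L \<subseteq> W - K}. ennreal (l K) + ennreal (l L))"
      unfolding inner_value_def by (rule ennreal_SUP_add_right[OF ne])
    also have "\<dots> \<le> inner_value W"
    proof (rule SUP_least)
      fix L assume "L \<in> {L. compact L \<and> L \<subseteq> W - K}"
      then have L: "compact L" "L \<subseteq> W - K" by auto
      then have "ennreal (l K) + ennreal (l L) = ennreal (l (K \<union> L))"
        using K by (subst additive) (auto simp: nonneg ennreal_plus)
      also have "\<dots> \<le> inner_value W" using K L by (intro le_inner_value) auto
      finally show "ennreal (l K) + ennreal (l L) \<le> inner_value W" .
    qed
    finally show ?thesis .
  qed
  have ne: "{K. compact K \<and> K \<subseteq> W \<inter> U} \<noteq> {}" by (auto intro!: exI[of _ "{}"])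
  have "inner_value (W \<inter> U) + outer_value (W - U)
      = (SUP K\<in>{K. compact K \<and> K \<subseteq> W \<inter> U}. outer_value (W - U) + ennreal (l K))"
    unfolding inner_value_def by (subst ennreal_SUP_add_right[OF ne, symmetric]) (simp add: add.commute)
  also have "\<dots> \<le> inner_value W"
  proof (rule SUP_least)
    fix K assume "K \<in> {K. compact K \<and> K \<subseteq> W \<inter> U}"
    then have K: "compact K" "K \<subseteq> W \<inter> U" by auto
    have "outer_value (W - U) \<le> inner_value (W - K)"
      using K assms by (intro outer_value_le) (auto simp: open_Diff compact_imp_closed)
    then show "outer_value (W - U) + ennreal (l K) \<le> inner_value W"
      using *[OF K] by (metis add.commute add_mono_thms_linordered_semiring(3) order_trans)
  qed
  finally show ?thesis .
qed

lemma open_in_lambda_system: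
  assumes "open U" shows "U \<in> lambda_system UNIV UNIV outer_value"
proof -
  have "outer_value (U \<inter> E) + outer_value ((UNIV - U) \<inter> E) = outer_value E" for E
  proof (rule antisym)
    show "outer_value (U \<inter> E) + outer_value ((UNIV - U) \<inter> E) \<le> outer_value E"
    proof (rule outer_value_greatest)
      fix W assume W: "open W" "E \<subseteq> W"
      have "outer_value (U \<inter> E) + outer_value ((UNIV - U) \<inter> E)
          \<le> inner_value (W \<inter> U) + outer_value (W - U)"
        using W assms by (intro add_mono outer_value_le outer_value_mono) auto
      also have "\<dots> \<le> inner_value W" using W assms by (intro inner_value_split_le)
      finally show "outer_value (U \<inter> E) + outer_value ((UNIV - U) \<inter> E) \<le> inner_value W" .
    qed
    \<comment> \<open>Only countable subadditivity is available, so the two pieces are padded by empty sets.\<close>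
    let ?D = "\<lambda>i::nat. if i = 0 then U \<inter> E else if i = 1 then (UNIV - U) \<inter> E else {}"
    have "E \<subseteq> (\<Union>i. ?D i)"
    proof
      fix x assume "x \<in> E"
      then have "x \<in> ?D 0 \<or> x \<in> ?D 1" by auto
      then show "x \<in> (\<Union>i. ?D i)" by blast
    qed
    then have "outer_value E \<le> outer_value (\<Union>i. ?D i)" by (rule outer_value_mono)
    also have "\<dots> \<le> (\<Sum>i. outer_value (?D i))" by (rule outer_value_UN_le)
    also have "\<dots> = (\<Sum>i\<in>{0,1}. outer_value (?D i))"
      by (rule suminf_finite) (auto simp: outer_value_empty)
    finally show "outer_value E \<le> outer_value (U \<inter> E) + outer_value ((UNIV - U) \<inter> E)" by simp
  qed
  then show ?thesis by (simp add: lambda_system_def)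
qed

lemma sets_induced_measure [simp, measurable_cong]: "sets induced_measure = sets borel"
  and space_induced_measure [simp]: "space induced_measure = UNIV"
  using sets.sets_measure_of_eq[of borel outer_value]
  by (simp_all add: induced_measure_def)

lemma emeasure_induced_measure:
  assumes "A \<in> sets borel" shows "emeasure induced_measure A = outer_value A"
proof (rule emeasure_measure_of[OF induced_measure_def])
  interpret pow: sigma_algebra "UNIV :: 'a set" UNIV
    using sigma_algebra_Pow[of UNIV] by simp
  let ?L = "lambda_system UNIV UNIV outer_value"
  have ms: "measure_space UNIV ?L outer_value"
    by (rule pow.caratheodory_lemma[OF outer_measure_space_outer_value])
  then interpret L: sigma_algebra UNIV ?L by (simp add: measure_space_def)
  have "sets borel \<subseteq> ?L"
    unfolding borel_def by (auto simp: open_in_lambda_system dest!: L.sigma_sets_subset[of "{S. open S}", THEN subsetD, rotated])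
  then show "countably_additive (sets induced_measure) outer_value"
    using ms by (auto simp: measure_space_def countably_additive_def)
  show "positive (sets induced_measure) outer_value"
    by (simp add: positive_def outer_value_empty)
qed (use assms in auto)

text \<open>
  Invariance is assumed for \<open>h\<close> and for its right inverse because continuity alone transports compact
  sets forward and open sets backward, which yields one inequality for each of the two maps.
\<close>

lemma distr_induced_measure:
  assumes h: "continuous_on UNIV h" "\<And>K. compact K \<Longrightarrow> l (h ` K) = l K"
    and h': "continuous_on UNIV h'" "\<And>K. compact K \<Longrightarrow> l (h' ` K) = l K"
    and inverse: "\<And>x. h (h' x) = x"
  shows "distr induced_measure borel h = induced_measure"
proof -
  have le: "outer_value (k -` E) \<le> outer_value E"
    if k: "continuous_on UNIV k" "\<And>K. compact K \<Longrightarrow> l (k ` K) = l K" for k E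
  proof (rule outer_value_greatest)
    fix U assume U: "open U" "E \<subseteq> U"
    have "outer_value (k -` E) \<le> inner_value (k -` U)"
      using U k by (intro outer_value_le) (auto intro: open_vimage)
    also have "\<dots> \<le> inner_value U"
    proof (rule inner_value_least)
      fix K assume K: "compact K" "K \<subseteq> k -` U"
      have "compact (k ` K)"
        using K k by (intro compact_continuous_image) (auto intro: continuous_on_subset)
      then have "ennreal (l (k ` K)) \<le> inner_value U"
        using K by (intro le_inner_value) auto
      then show "ennreal (l K) \<le> inner_value U" using k K by simp
    qed
    finally show "outer_value (k -` E) \<le> inner_value U" .
  qed
  have [measurable]: "h \<in> borel_measurable borel"
    using h by (intro borel_measurable_continuous_onI)
  show ?thesis
  proof (rule measure_eqI)
    fix A assume "A \<in> sets (distr induced_measure borel h)"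
    then have A[measurable]: "A \<in> sets borel" by simp
    have "h -` A \<in> sets borel" using measurable_sets[of h borel borel A] by simp
    then have "emeasure (distr induced_measure borel h) A = outer_value (h -` A)"
      by (simp add: emeasure_distr emeasure_induced_measure)
    also have "\<dots> = outer_value A"
      using le[OF h, of A] le[OF h', of "h -` A"] inverse by (simp add: vimage_def)
    finally show "emeasure (distr induced_measure borel h) A = emeasure induced_measure A"
      by (simp add: emeasure_induced_measure)
  qed simp
qed

end

section \<open>Left-invariant measures on locally compact groups\<close>

lemma compact_product_of_intervals: "compact (\<Pi>\<^sub>E i\<in>UNIV. {a i..b i :: real})"
proof -
  have "compactin (product_topology (\<lambda>i. euclidean) UNIV) (\<Pi>\<^sub>E i\<in>UNIV. {a i..b i})"
    unfolding compactin_PiE compactin_euclidean_iff by (blast intro: compact_Icc)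
  then show ?thesis unfolding euclidean_product_topology compactin_euclidean_iff .
qed

text \<open>
  Tychonoff's theorem in the form used below: although no subsequence need converge at
  uncountably many points \<open>i\<close> simultaneously, some filter finer than \<open>sequentially\<close> does.
\<close>

lemma cluster_filter_of_bounded_functions:
  fixes f :: "nat \<Rightarrow> 'i \<Rightarrow> real"
  assumes "\<And>n i. f n i \<in> {a i..b i}"
  obtains H l where "H \<noteq> bot" "H \<le> sequentially" "\<And>i. ((\<lambda>n. f n i) \<longlongrightarrow> l i) H"
proof -
  have 1: "\<forall>\<^sub>F g in filtermap f sequentially. g \<in> (\<Pi>\<^sub>E i\<in>UNIV. {a i..b i})"
    unfolding eventually_filtermap
    using assms by (intro always_eventually allI PiE_I) (blast, simp)
  have 2: "filtermap f sequentially \<noteq> bot"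
    unfolding filtermap_bot_iff by (rule sequentially_bot)
  obtain l where l: "inf (nhds l) (filtermap f sequentially) \<noteq> bot"
    using iffD1[OF compact_filter compact_product_of_intervals, rule_format, OF 2 1] by (elim bexE)
  \<comment> \<open>Pulled back to the index set, the neighbourhoods of the cluster point \<open>l\<close> give the filter.\<close>
  define H where "H = inf sequentially (filtercomap f (nhds l))"
  show thesis
  proof
    show "H \<noteq> bot"
    proof
      assume "H = bot"
      then have "eventually (\<lambda>_. False) H" by simp
      then obtain P Q where PQ: "eventually P sequentially" "eventually Q (filtercomap f (nhds l))"
          "\<And>n. P n \<Longrightarrow> Q n \<Longrightarrow> False"
        unfolding H_def eventually_inf by blast
      then obtain R where R: "eventually R (nhds l)" "\<And>n. R (f n) \<Longrightarrow> Q n"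
        by (auto simp: eventually_filtercomap)
      have "eventually (\<lambda>g. \<not> R g) (filtermap f sequentially)"
        unfolding eventually_filtermap using PQ(1) by eventually_elim (use PQ R in auto)
      then have "eventually (\<lambda>_. False) (inf (nhds l) (filtermap f sequentially))"
        using R(1) unfolding eventually_inf by blast
      then show False using l by (simp add: eventually_False)
    qed
    show "H \<le> sequentially" by (simp add: H_def)
    fix i
    have "(f \<longlongrightarrow> l) H"
      unfolding H_def filterlim_def by (meson filtermap_le_iff_le_filtercomap inf_le2)
    then show "((\<lambda>n. f n i) \<longlongrightarrow> l i) H"
      by (rule continuous_on_tendsto_compose[OF continuous_on_product_coordinates]) auto
  qed
qed

definition coverable :: "'g::group_add set \<Rightarrow> 'g set \<Rightarrow> bool" where
  "coverable U A \<longleftrightarrow> (\<exists>F. finite F \<and> A \<subseteq> (\<Union>g\<in>F. (+) g ` U))"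

text \<open>
  The index \<open>(A : U)\<close> of Weil's construction, meaningful only for coverable sets.
\<close>

definition covering_number :: "'g::group_add set \<Rightarrow> 'g set \<Rightarrow> nat" where
  "covering_number U A = (LEAST n. \<exists>F. finite F \<and> card F = n \<and> A \<subseteq> (\<Union>g\<in>F. (+) g ` U))"

lemma coverableI: "finite F \<Longrightarrow> A \<subseteq> (\<Union>g\<in>F. (+) g ` U) \<Longrightarrow> coverable U A"
  unfolding coverable_def by blast

lemma covering_number_le_card:
  "finite F \<Longrightarrow> A \<subseteq> (\<Union>g\<in>F. (+) g ` U) \<Longrightarrow> covering_number U A \<le> card F"
  unfolding covering_number_def by (rule Least_le) auto

lemma coverable_optimal_cover:
  assumes "coverable U A"
  obtains F where "finite F" "card F = covering_number U A" "A \<subseteq> (\<Union>g\<in>F. (+) g ` U)"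
proof -
  have "\<exists>n F. finite F \<and> card F = n \<and> A \<subseteq> (\<Union>g\<in>F. (+) g ` U)"
    using assms by (auto simp: coverable_def)
  from LeastI_ex[OF this] show thesis
    using that unfolding covering_number_def by blast
qed

lemma coverable_subset: "coverable U B \<Longrightarrow> A \<subseteq> B \<Longrightarrow> coverable U A"
  unfolding coverable_def by blast

lemma covering_number_mono:
  assumes "coverable U B" "A \<subseteq> B" shows "covering_number U A \<le> covering_number U B"
proof -
  obtain F where "finite F" "card F = covering_number U B" "B \<subseteq> (\<Union>g\<in>F. (+) g ` U)"
    using assms(1) by (rule coverable_optimal_cover)
  then show ?thesis using covering_number_le_card[of F A U] assms(2) by auto
qed

lemma covering_number_pos:
  assumes "coverable U A" "A \<noteq> {}" shows "0 < covering_number U A"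
proof -
  obtain F where "finite F" "card F = covering_number U A" "A \<subseteq> (\<Union>g\<in>F. (+) g ` U)"
    using assms(1) by (rule coverable_optimal_cover)
  then show ?thesis using assms(2) by (metis UN_empty card_gt_0_iff subset_empty)
qed

lemma covering_number_Un_le:
  assumes "coverable U A" "coverable U B"
  shows "covering_number U (A \<union> B) \<le> covering_number U A + covering_number U B"
proof -
  obtain F where F: "finite F" "card F = covering_number U A" "A \<subseteq> (\<Union>g\<in>F. (+) g ` U)"
    using assms(1) by (rule coverable_optimal_cover)
  obtain F' where F': "finite F'" "card F' = covering_number U B" "B \<subseteq> (\<Union>g\<in>F'. (+) g ` U)"
    using assms(2) by (rule coverable_optimal_cover)
  have "covering_number U (A \<union> B) \<le> card (F \<union> F')"
    using F F' by (intro covering_number_le_card) auto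
  also have "\<dots> \<le> card F + card F'" by (rule card_Un_le)
  finally show ?thesis using F F' by simp
qed

text \<open>
  In an optimal cover no translate meets both sets, so the cover splits into covers of each.
\<close>

lemma covering_number_Un_separated:
  assumes "coverable U (A \<union> B)" and sep: "\<And>g. (+) g ` U \<inter> A = {} \<or> (+) g ` U \<inter> B = {}"
  shows "covering_number U A + covering_number U B \<le> covering_number U (A \<union> B)"
proof -
  obtain F where F: "finite F" "card F = covering_number U (A \<union> B)" "A \<union> B \<subseteq> (\<Union>g\<in>F. (+) g ` U)"
    using assms(1) by (rule coverable_optimal_cover)
  define FA where "FA = {g\<in>F. (+) g ` U \<inter> A \<noteq> {}}"
  define FB where "FB = {g\<in>F. (+) g ` U \<inter> B \<noteq> {}}"
  have "covering_number U A \<le> card FA" "covering_number U B \<le> card FB"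
    using F by (intro covering_number_le_card; force simp: FA_def FB_def)+
  moreover have "card FA + card FB = card (FA \<union> FB)"
    using F sep by (intro card_Un_disjoint[symmetric]) (auto simp: FA_def FB_def)
  moreover have "\<dots> \<le> card F"
    using F by (intro card_mono) (auto simp: FA_def FB_def)
  ultimately show ?thesis using F by simp
qed

lemma covering_number_trans:
  assumes "coverable V A" "coverable U V"
  shows "covering_number U A \<le> covering_number V A * covering_number U V"
proof -
  obtain F where F: "finite F" "card F = covering_number V A" "A \<subseteq> (\<Union>g\<in>F. (+) g ` V)"
    using assms(1) by (rule coverable_optimal_cover)
  obtain F' where F': "finite F'" "card F' = covering_number U V" "V \<subseteq> (\<Union>g\<in>F'. (+) g ` U)"
    using assms(2) by (rule coverable_optimal_cover)
  let ?S = "(\<lambda>(g, h). g + h) ` (F \<times> F')"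
  have sub: "A \<subseteq> (\<Union>g\<in>?S. (+) g ` U)"
  proof
    fix a assume "a \<in> A"
    then obtain g v where "g \<in> F" "v \<in> V" "a = g + v" using F by blast
    moreover from this obtain h u where "h \<in> F'" "u \<in> U" "v = h + u" using F' by blast
    ultimately have "g + h \<in> ?S" "a \<in> (+) (g + h) ` U" by (auto simp: add.assoc)
    then show "a \<in> (\<Union>g\<in>?S. (+) g ` U)" by blast
  qed
  have "covering_number U A \<le> card ?S" using F F' sub by (intro covering_number_le_card) auto
  also have "\<dots> \<le> card (F \<times> F')" using F F' by (intro card_image_le) auto
  finally show ?thesis
    using F F' by (simp add: card_cartesian_product)
qed

lemma coverable_translate:
  assumes "coverable U A" shows "coverable U ((+) h ` A)"
    and "covering_number U ((+) h ` A) \<le> covering_number U A"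
proof -
  obtain F where F: "finite F" "card F = covering_number U A" "A \<subseteq> (\<Union>g\<in>F. (+) g ` U)"
    using assms(1) by (rule coverable_optimal_cover)
  have sub: "(+) h ` A \<subseteq> (\<Union>g\<in>(+) h ` F. (+) g ` U)"
    using F(3) by (auto simp: add.assoc image_iff subset_iff)
  show "coverable U ((+) h ` A)" by (rule coverableI[OF _ sub]) (use F in simp)
  have "covering_number U ((+) h ` A) \<le> card ((+) h ` F)"
    using F sub by (intro covering_number_le_card) auto
  also have "\<dots> \<le> card F" using F by (intro card_image_le)
  finally show "covering_number U ((+) h ` A) \<le> covering_number U A" using F by simp
qed

lemma covering_number_translate:
  assumes "coverable U A" shows "covering_number U ((+) h ` A) = covering_number U A"
proof (rule antisym)
  have "(+) (- h) ` (+) h ` A = A" by (simp add: image_image)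
  then show "covering_number U A \<le> covering_number U ((+) h ` A)"
    using coverable_translate(2)[OF coverable_translate(1)[OF assms, of h], of "- h"] by simp
qed (rule coverable_translate[OF assms])

lemma open_translation_image:
  fixes U :: "'g::topological_group_add set"
  assumes "open U" shows "open ((+) g ` U)"
proof -
  have "(+) g ` U = (+) (- g) -` U"
    by (force simp: image_iff add.assoc[symmetric])
  then show ?thesis
    using assms by (auto intro!: open_vimage continuous_intros)
qed

lemma compact_coverable:
  fixes K :: "'g::topological_group_add set"
  assumes "compact K" "open U" "U \<noteq> {}"
  shows "coverable U K"
proof -
  obtain u where u: "u \<in> U" using assms by auto
  have "x \<in> (+) (x - u) ` U" for x
    using u by (intro image_eqI[of _ _ u]) auto
  then have "K \<subseteq> (\<Union>g\<in>UNIV. (+) g ` U)" by blast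
  then show ?thesis
    using compactE_image[OF assms(1), of UNIV "\<lambda>g. (+) g ` U"] open_translation_image[OF assms(2)]
    by (metis coverableI)
qed


lemma compact_has_compact_neighbourhood:
  fixes K :: "'a::t2_space set"
  assumes "locally_compact_space (euclidean :: 'a topology)" "compact K"
  obtains U L where "open U" "compact L" "K \<subseteq> U" "U \<subseteq> L"
  using assms locally_compact_space_compact_closed_compact[OF disjI1, OF Hausdorff_space_euclidean_t2]
  by (metis compactin_euclidean_iff open_openin)

text \<open>
  If a translate \<open>g + U n\<close> meets both \<open>K\<close> and \<open>L\<close>, then some \<open>- k + l\<close> equals \<open>- u + v\<close> with
  \<open>u, v\<close> in \<open>U n\<close>. The elements \<open>- k + l\<close> form a compact set avoiding \<open>0\<close>, whereas \<open>- u + v\<close>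
  tends to \<open>0\<close>.
\<close>

lemma eventually_translates_separate_compacts:
  fixes K L :: "'g::{topological_group_add, t2_space} set" and U :: "nat \<Rightarrow> 'g set"
  assumes "compact K" "compact L" "K \<inter> L = {}"
    and U: "\<And>S. open S \<Longrightarrow> 0 \<in> S \<Longrightarrow> eventually (\<lambda>n. U n \<subseteq> S) sequentially"
  shows "\<forall>\<^sub>F n in sequentially. \<forall>g. (+) g ` U n \<inter> K = {} \<or> (+) g ` U n \<inter> L = {}"
proof -
  define N where "N = (\<lambda>(k, l). - k + l) ` (K \<times> L)"
  have "compact N"
    unfolding N_def case_prod_beta using assms(1,2)
    by (intro compact_continuous_image compact_Times continuous_intros)
  then have "open (- N)" by (auto dest: compact_imp_closed)
  moreover have cont: "continuous_on UNIV (\<lambda>(u::'g, v). - u + v)"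
    unfolding case_prod_beta by (intro continuous_intros)
  ultimately have "open ((\<lambda>(u, v). - u + v) -` (- N))"
    by (rule open_vimage)
  moreover have "0 \<notin> N"
  proof
    assume "0 \<in> N"
    then obtain k l where "k \<in> K" "l \<in> L" "- k + l = 0" by (auto simp: N_def)
    moreover from this have "k + (- k + l) = k" by simp
    then have "l = k" by (simp add: add.assoc[symmetric])
    ultimately show False using assms(3) by auto
  qed
  then have "(0, 0) \<in> (\<lambda>(u, v). - u + v) -` (- N)" by simp
  ultimately obtain A B where AB: "open A" "open B" "0 \<in> A" "0 \<in> B"
      "A \<times> B \<subseteq> (\<lambda>(u, v). - u + v) -` (- N)"
    by (elim open_prod_elim) auto
  have "eventually (\<lambda>n. U n \<subseteq> A \<inter> B) sequentially"
    using AB by (intro U) auto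
  then show ?thesis
  proof eventually_elim
    case (elim n)
    show ?case
    proof (rule allI, rule ccontr)
      fix g assume "\<not> ((+) g ` U n \<inter> K = {} \<or> (+) g ` U n \<inter> L = {})"
      then obtain u v where uv: "u \<in> U n" "g + u \<in> K" "v \<in> U n" "g + v \<in> L" by auto
      have "- (g + u) + (g + v) \<in> N" using uv by (force simp: N_def)
      moreover have "- (g + u) + (g + v) = - u + v"
        by (simp only: minus_add add.assoc minus_add_cancel)
      moreover have "(u, v) \<in> A \<times> B" using uv elim by auto
      then have "- u + v \<notin> N" using AB(5) by auto
      ultimately show False by simp
    qed
  qed
qed

text \<open>
  Existence of Haar measure. Covering numbers by translates of \<open>U n\<close>, where \<open>U n\<close> shrinks to \<open>0\<close>,
  are normalized by the covering number of a fixed neighbourhood \<open>V0\<close>; transitivity of covering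
  bounds the quotient for \<open>K\<close> by the covering number of \<open>K\<close> by \<open>V0\<close>, independently of \<open>n\<close>.
  The limit is subadditive because covering numbers are, and additive on disjoint compact sets
  because small translates cannot meet both. It is nonzero because a compact set containing \<open>V0\<close>
  has quotient at least \<open>1\<close>.
\<close>

theorem exists_left_invariant_measure:
  assumes "locally_compact_space
    (euclidean :: 'g::{topological_group_add, first_countable_topology, t2_space} topology)"
  shows "\<exists>M :: 'g measure. sets M = sets borel \<and> (\<forall>g. distr M borel ((+) g) = M) \<and>
    (\<forall>K. compact K \<longrightarrow> emeasure M K < \<infinity>) \<and> (\<forall>U. open U \<longrightarrow> U \<noteq> {} \<longrightarrow> 0 < emeasure M U)"
proof -
  obtain V0 C0 :: "'g set" where V0: "open V0" "compact C0" "0 \<in> V0" "V0 \<subseteq> C0"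
    using compact_has_compact_neighbourhood[OF assms, of "{0}"] by auto
  obtain U :: "nat \<Rightarrow> 'g set" where U: "\<And>n. open (U n)" "\<And>n. 0 \<in> U n"
      "\<And>S. open S \<Longrightarrow> 0 \<in> S \<Longrightarrow> eventually (\<lambda>n. U n \<subseteq> S) sequentially"
    by (rule countable_basis_at_decseq[of 0]) blast
  define c where "c n A = real (covering_number (U n) A)" for n A
  define f where "f n K = (if compact K then c n K / c n V0 else 0)" for n K
  have cov: "coverable (U n) K" if "compact K" for n K
    using that U by (intro compact_coverable) auto
  have covV0: "coverable (U n) V0" for n
    using V0 cov[OF V0(2)] by (rule_tac coverable_subset)
  have pos: "0 < c n V0" for n
    using covering_number_pos[OF covV0] V0(3) by (auto simp: c_def)
  have bound: "f n K \<in> {0..real (covering_number V0 K)}" for n K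
  proof (cases "compact K")
    case True
    have "c n K \<le> real (covering_number V0 K) * c n V0"
      unfolding c_def of_nat_mult[symmetric] of_nat_le_iff
      using V0 by (intro covering_number_trans compact_coverable True covV0) auto
    then show ?thesis
      using True pos[of n] by (auto simp: f_def divide_le_eq) (simp add: c_def)
  qed (simp add: f_def)
  obtain H l where H: "H \<noteq> bot" "H \<le> sequentially" and lim: "\<And>K. ((\<lambda>n. f n K) \<longlongrightarrow> l K) H"
    using cluster_filter_of_bounded_functions[of f, OF bound] by blast
  have ev: "eventually P H" if "eventually P sequentially" for P
    using H(2) that by (rule filter_leD)
  interpret compact_content l
  proof
    fix K L :: "'g set"
    assume K: "compact K"
    show "0 \<le> l K"
      using bound by (intro tendsto_lowerbound[OF lim _ H(1)]) auto
    assume L: "compact L"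
    show "l K \<le> l L" if "K \<subseteq> L"
    proof -
      have "c n K \<le> c n L" for n
        unfolding c_def of_nat_le_iff by (rule covering_number_mono[OF cov[OF L] that])
      then have "f n K \<le> f n L" for n
        using K L pos[of n] by (simp add: f_def divide_right_mono)
      then show ?thesis
        by (intro tendsto_le[OF H(1) lim lim] always_eventually) auto
    qed
    have le: "f n (K \<union> L) \<le> f n K + f n L" for n
    proof -
      have "c n (K \<union> L) \<le> c n K + c n L"
        unfolding c_def of_nat_add[symmetric] of_nat_le_iff
        using K L by (intro covering_number_Un_le cov)
      then show ?thesis
        using K L pos[of n] by (auto simp: f_def add_divide_distrib[symmetric] intro!: divide_right_mono)
    qed
    show "l (K \<union> L) \<le> l K + l L"
      using le by (intro tendsto_le[OF H(1) tendsto_add[OF lim lim] lim] always_eventually) auto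
    assume disj: "K \<inter> L = {}"
    have "\<forall>\<^sub>F n in sequentially. f n (K \<union> L) = f n K + f n L"
      using eventually_translates_separate_compacts[of K L U, OF K L disj U(3), simplified]
    proof eventually_elim
      case (elim n)
      have "c n K + c n L \<le> c n (K \<union> L)"
        unfolding c_def of_nat_add[symmetric] of_nat_le_iff
        using K L elim by (intro covering_number_Un_separated cov compact_Un) auto
      then have "f n K + f n L \<le> f n (K \<union> L)"
        using K L pos[of n] by (auto simp: f_def add_divide_distrib[symmetric] intro!: divide_right_mono)
      then show ?case using le[of n] by simp
    qed
    then have "((\<lambda>n. f n K + f n L) \<longlongrightarrow> l (K \<union> L)) H"
      by (rule Lim_transform_eventually[OF lim ev])
    then show "l (K \<union> L) = l K + l L"
      by (rule tendsto_unique[OF H(1) _ tendsto_add[OF lim lim]])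
  qed
  have trans_compact: "compact ((+) g ` K)" if "compact K" for g and K :: "'g set"
    using that by (intro compact_continuous_image continuous_intros)
  have invariant: "l ((+) g ` K) = l K" if "compact K" for g K
  proof -
    have "f n ((+) g ` K) = f n K" for n
      using that trans_compact[OF that, of g] covering_number_translate[OF cov[OF that]]
      by (simp add: f_def c_def)
    then show ?thesis
      using lim[of "(+) g ` K"] by (intro tendsto_unique[OF H(1) _ lim]) simp
  qed
  have "1 \<le> l C0"
  proof (rule tendsto_lowerbound[OF lim _ H(1)])
    have "c n V0 \<le> c n C0" for n
      using covering_number_mono[OF cov[OF V0(2)] V0(4)] by (simp add: c_def)
    then show "\<forall>\<^sub>F n in H. 1 \<le> f n C0"
      using pos V0 by (intro always_eventually) (simp add: f_def)
  qed
  have invM: "distr induced_measure borel ((+) g) = induced_measure" for g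
    by (rule distr_induced_measure[where h' = "(+) (- g)"]) (auto intro!: continuous_intros invariant)
  have M_translate: "emeasure induced_measure ((+) g ` A) = emeasure induced_measure A"
    if A: "open A" for g A
  proof -
    have [measurable]: "A \<in> sets borel" "(+) g ` A \<in> sets borel"
      using A open_translation_image[OF A] by auto
    have "(+) g -` (+) g ` A = A" by auto
    moreover have "(+) g \<in> borel_measurable borel"
      by (intro borel_measurable_continuous_onI continuous_intros)
    ultimately show ?thesis
      using arg_cong[OF invM[of g], of "\<lambda>M. emeasure M ((+) g ` A)"]
      by (subst (asm) emeasure_distr) (auto cong: measurable_cong_sets)
  qed
  show ?thesis
  proof (intro exI[of _ induced_measure] conjI allI impI)
    show "distr induced_measure borel ((+) g) = induced_measure" for g by (rule invM)
    show "emeasure induced_measure K < \<infinity>" if K: "compact K" for K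
    proof -
      obtain W L where WL: "open W" "compact L" "K \<subseteq> W" "W \<subseteq> L"
        using compact_has_compact_neighbourhood[OF assms K] by blast
      have "emeasure induced_measure K = outer_value K"
        using K by (intro emeasure_induced_measure) (auto dest: compact_imp_closed)
      also have "\<dots> \<le> inner_value W" using WL by (intro outer_value_le)
      also have "\<dots> \<le> ennreal (l L)"
        using WL by (intro inner_value_least ennreal_leI mono) auto
      finally show ?thesis by (auto simp: top.not_eq_extremum[symmetric] top_unique)
    qed
    show "0 < emeasure induced_measure A" if A: "open A" "A \<noteq> {}" for A
    proof (rule ccontr)
      assume "\<not> 0 < emeasure induced_measure A"
      then have null: "emeasure induced_measure A = 0" by simp
      obtain F where F: "finite F" "C0 \<subseteq> (\<Union>g\<in>F. (+) g ` A)"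
        using compact_coverable[OF V0(2) A] unfolding coverable_def by blast
      have translate_in_borel: "(+) g ` A \<in> sets borel" for g
        using open_translation_image[OF A(1)] by auto
      have "ennreal 1 \<le> ennreal (l C0)" using \<open>1 \<le> l C0\<close> by (rule ennreal_leI)
      also have "\<dots> \<le> emeasure induced_measure C0"
        using V0 le_outer_value[of C0] by (simp add: emeasure_induced_measure compact_imp_closed)
      also have "\<dots> \<le> emeasure induced_measure (\<Union>g\<in>F. (+) g ` A)"
        using F translate_in_borel by (intro emeasure_mono) auto
      also have "\<dots> \<le> (\<Sum>g\<in>F. emeasure induced_measure ((+) g ` A))"
        using F translate_in_borel by (intro emeasure_subadditive_finite) auto
      also have "\<dots> = 0" using null A by (simp add: M_translate)
      finally show False by simp
    qed
  qed simp
qed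

section \<open>Equivariant kernels for proper actions\<close>

lemma countable_precompact_open_cover:
  assumes "locally_compact_space (euclidean :: 'a::{second_countable_topology, t2_space} topology)"
  obtains V L :: "nat \<Rightarrow> 'a::{second_countable_topology, t2_space} set"
  where "\<And>i. open (V i)" "\<And>i. compact (L i)" "\<And>i. V i \<subseteq> L i" "(\<Union>i. V i) = UNIV"
proof -
  let ?F = "{U :: 'a set. open U \<and> (\<exists>L. compact L \<and> U \<subseteq> L)}"
  obtain F where F: "F \<subseteq> ?F" "countable F" "\<Union>F = \<Union>?F"
    by (rule Lindelof[of ?F]) auto
  have "x \<in> \<Union>?F" for x :: 'a
  proof -
    obtain U L where "open U" "compact L" "{x} \<subseteq> U" "U \<subseteq> L"
      by (rule compact_has_compact_neighbourhood[OF assms, of "{x}"]) auto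
    then show ?thesis by blast
  qed
  then have cover: "\<Union>F = UNIV" using F by auto
  then have ne: "F \<noteq> {}" by auto
  define V where "V = from_nat_into F"
  have V: "V i \<in> F" for i using ne by (simp add: V_def from_nat_into)
  then have "\<forall>i. \<exists>L. compact L \<and> V i \<subseteq> L" using F(1) by auto
  then obtain L where "\<And>i. compact (L i)" "\<And>i. V i \<subseteq> L i" by metis
  moreover have "open (V i)" for i using V F(1) by auto
  moreover have "(\<Union>i. V i) = UNIV"
    using cover range_from_nat_into[OF ne F(2)] by (simp add: V_def)
  ultimately show thesis using that by blast
qed

lemma continuous_actionD:
  assumes "continuous_action act"
  shows "act 0 x = x" "act (g + h) x = act g (act h x)" "act (- g) (act g x) = x"
    "act g (act (- g) x) = x" "continuous_on UNIV (\<lambda>(g, x). act g x)"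
proof -
  show *: "act 0 x = x" "act (g + h) x = act g (act h x)" for g h x
    using assms unfolding continuous_action_def by blast+
  show "act (- g) (act g x) = x" "act g (act (- g) x) = x"
    using *(2)[of "- g" g x] *(2)[of g "- g" x] *(1)[of x] by simp_all
  show "continuous_on UNIV (\<lambda>(g, x). act g x)"
    using assms unfolding continuous_action_def by blast
qed

lemma continuous_on_action:
  assumes "continuous_action act" "continuous_on A f" "continuous_on A h"
  shows "continuous_on A (\<lambda>y. act (f y) (h y))"
  using continuous_on_compose2[OF continuous_actionD(5)[OF assms(1)] continuous_on_Pair[OF assms(2,3)]]
  by simp

lemma compact_returning_elements:
  fixes act :: "'g::topological_group_add \<Rightarrow> 's::topological_space \<Rightarrow> 's"
  assumes "proper_action act" "compact K"
  shows "compact {g. \<exists>t\<in>K. act g t \<in> K}"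
proof -
  have "compactin euclidean {x \<in> topspace euclidean. (case x of (g, x) \<Rightarrow> (act g x, x)) \<in> K \<times> K}"
    using assms unfolding proper_action_def
    by (intro compactin_proper_map_preimage) (auto simp: compact_Times)
  then have "compact {x. (case x of (g, x) \<Rightarrow> (act g x, x)) \<in> K \<times> K}" by simp
  then have "compact (fst ` {x. (case x of (g, x) \<Rightarrow> (act g x, x)) \<in> K \<times> K})"
    by (rule compact_continuous_image[rotated]) (intro continuous_intros)
  also have "fst ` {x. (case x of (g, x) \<Rightarrow> (act g x, x)) \<in> K \<times> K} = {g. \<exists>t\<in>K. act g t \<in> K}"
    by (force simp: image_iff)
  finally show ?thesis .
qed

lemma sigma_finite_if_finite_on_compacts:
  fixes M :: "'a::{second_countable_topology, t2_space} measure"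
  assumes "locally_compact_space (euclidean :: 'a topology)" "sets M = sets borel"
    and "\<And>K. compact K \<Longrightarrow> emeasure M K < \<infinity>"
  shows "sigma_finite_measure M"
proof
  obtain V L :: "nat \<Rightarrow> 'a set" where VL: "\<And>i. open (V i)" "\<And>i. compact (L i)" "\<And>i. V i \<subseteq> L i"
      "(\<Union>i. V i) = UNIV" using countable_precompact_open_cover[OF assms(1)] by blast
  show "\<exists>A. countable A \<and> A \<subseteq> sets M \<and> \<Union>A = space M \<and> (\<forall>a\<in>A. emeasure M a \<noteq> \<infinity>)"
  proof (intro exI[of _ "range L"] conjI ballI)
    show "\<Union>(range L) = space M"
      using VL(3) unfolding sets_eq_imp_space_eq[OF assms(2)] space_borel VL(4)[symmetric]
      by (auto simp: VL(4)) (metis UNIV_I UN_iff VL(4) subsetD)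
  qed (use VL assms in \<open>auto simp: compact_imp_closed less_top\<close>)
qed

text \<open>
  For a Haar measure \<open>M\<close> and a weight \<open>c\<close> on \<open>S\<close>, left invariance makes the measures
  \<open>c (g\<^sup>-\<^sup>1 s) dM(g)\<close> on \<open>G\<close> equivariant in \<open>s\<close>, so only their total mass \<open>F s\<close> has to be kept
  between \<open>0\<close> and \<open>\<infinity>\<close>. With \<open>c\<close> the indicator of a precompact open set \<open>V\<close>, properness and left
  invariance bound \<open>F\<close> uniformly, and \<open>F\<close> is positive on the orbits that meet \<open>V\<close>; a weighted sum
  over a countable cover by such sets is then finite and positive everywhere.
\<close>

theorem exists_equivariant_kernel_of_proper_action:
  fixes act :: "'g::{topological_group_add, second_countable_topology, t2_space} \<Rightarrow>
                  's::{second_countable_topology, t2_space} \<Rightarrow> 's"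
  assumes lcG: "locally_compact_space (euclidean :: 'g topology)"
    and lcS: "locally_compact_space (euclidean :: 's topology)"
    and act: "continuous_action act" and proper: "proper_action act"
  shows "\<exists>\<tau>. \<tau> \<in> borel \<rightarrow>\<^sub>M prob_algebra borel \<and>
    (\<forall>g s. distr (\<tau> s) borel ((+) g) = \<tau> (act g s))"
proof -
  note act_simps = continuous_actionD(1-4)[OF act]
  obtain M :: "'g measure" where sets_M[measurable_cong]: "sets M = sets borel"
    and inv: "\<And>g. distr M borel ((+) g) = M"
    and fin: "\<And>K. compact K \<Longrightarrow> emeasure M K < \<infinity>"
    and pos: "\<And>U. open U \<Longrightarrow> U \<noteq> {} \<Longrightarrow> 0 < emeasure M U"
    using exists_left_invariant_measure[OF lcG] by blast
  interpret M: sigma_finite_measure M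
    by (rule sigma_finite_if_finite_on_compacts[OF lcG sets_M fin])
  have space_M: "space M = UNIV" using sets_eq_imp_space_eq[OF sets_M] by simp
  have trans_measurable[measurable]: "(+) g \<in> borel_measurable borel" for g :: 'g
    by (intro borel_measurable_continuous_onI continuous_intros)
  have shift: "(\<integral>\<^sup>+g. f (h + g) \<partial>M) = (\<integral>\<^sup>+g. f g \<partial>M)"
    if [measurable]: "f \<in> borel_measurable borel" for f h
    by (subst (2) inv[of h, symmetric], subst nn_integral_distr) simp_all
  obtain V L :: "nat \<Rightarrow> 's set" where VL: "\<And>i. open (V i)" "\<And>i. compact (L i)" "\<And>i. V i \<subseteq> L i"
      "(\<Union>i. V i) = UNIV" using countable_precompact_open_cover[OF lcS] by blast
  have V_measurable[measurable]: "V i \<in> sets borel" for i using VL by auto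
  have act_measurable[measurable]: "(\<lambda>(s, g). act (- g) s) \<in> borel \<Otimes>\<^sub>M borel \<rightarrow>\<^sub>M borel"
    unfolding borel_prod case_prod_beta
    by (intro borel_measurable_continuous_onI continuous_on_action[OF act] continuous_intros)
  have act_measurable1: "(\<lambda>g. act (- g) s) \<in> borel_measurable borel" for s
    by (intro borel_measurable_continuous_onI continuous_on_action[OF act] continuous_intros)
  define T where "T i s = {g. act (- g) s \<in> V i}" for i s
  have T_open: "open (T i s)" for i s
  proof -
    have "T i s = (\<lambda>g. act (- g) s) -` V i" by (auto simp: T_def)
    then show ?thesis
      using VL by (auto intro!: open_vimage continuous_on_action[OF act] continuous_intros)
  qed
  have T_measurable[measurable]: "T i s \<in> sets borel" for i s using T_open by simp
  \<comment> \<open>Properness makes the return set of \<open>L i\<close> compact; up to a left translation, \<open>T i s\<close> lies in its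
      inverse, whatever \<open>s\<close> is.\<close>
  define R where "R i = {g. \<exists>t\<in>L i. act g t \<in> L i}" for i
  have R_compact: "compact (uminus ` R i)" for i
    unfolding R_def by (intro compact_continuous_image continuous_intros
        compact_returning_elements[OF proper] VL)
  define b where "b i = emeasure M (uminus ` R i)" for i
  have T_le: "emeasure M (T i s) \<le> b i" for i s
  proof (cases "T i s = {}")
    case False
    then obtain h where h: "act (- h) s \<in> V i" by (auto simp: T_def)
    have [measurable]: "uminus ` R i \<in> sets borel"
      using R_compact[of i] by (auto dest: compact_imp_closed)
    have sub: "T i s \<subseteq> (+) (- h) -` (uminus ` R i)"
    proof
      fix g assume g: "g \<in> T i s"
      have "act (- g + h) (act (- h) s) = act (- g) s"
        by (simp add: act_simps)
      then have "- g + h \<in> R i"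
        using g h VL(3)[of i] by (auto simp: R_def T_def intro!: bexI[of _ "act (- h) s"])
      then have "- (- g + h) \<in> uminus ` R i" by blast
      then show "g \<in> (+) (- h) -` (uminus ` R i)" by (simp only: vimage_eq minus_add minus_minus)
    qed
    have "emeasure M (T i s) \<le> emeasure M ((+) (- h) -` (uminus ` R i))"
      using sub measurable_sets[OF trans_measurable, of "uminus ` R i" "- h"]
      by (intro emeasure_mono) (auto simp: sets_M)
    also have "\<dots> = emeasure (distr M borel ((+) (- h))) (uminus ` R i)"
      by (subst emeasure_distr) (auto simp: space_M)
    finally show ?thesis by (simp add: inv b_def)
  qed simp
  \<comment> \<open>Adding \<open>1\<close> keeps the denominator positive, so that the masses of the pieces sum to at most \<open>1\<close>.\<close>
  define w where "w i = ennreal ((1/2) ^ Suc i) / (1 + b i)" for i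
  have b_fin: "b i < \<infinity>" for i unfolding b_def by (intro fin R_compact)
  have w_pos: "0 < w i" for i
    using b_fin[of i] by (auto simp: w_def ennreal_zero_less_divide less_top)
  have w_le: "w i * emeasure M (T i s) \<le> ennreal ((1/2) ^ Suc i)" for i s
  proof -
    have "w i * emeasure M (T i s) \<le> w i * (1 + b i)"
      by (intro mult_left_mono order_trans[OF T_le]) (auto simp: add_increasing)
    also have "\<dots> = ennreal ((1/2) ^ Suc i)"
      unfolding w_def using b_fin[of i]
      by (intro ennreal_divide_times[THEN trans] ennreal_mult_divide_eq[THEN trans]) auto
    finally show ?thesis .
  qed
  define c where "c s = (\<Sum>i. w i * indicator (V i) s)" for s
  have [measurable]: "c \<in> borel_measurable borel" unfolding c_def by measurable
  define F where "F s = (\<integral>\<^sup>+g. c (act (- g) s) \<partial>M)" for s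
  have F_eq: "F s = (\<Sum>i. w i * emeasure M (T i s))" for s
  proof -
    have "F s = (\<integral>\<^sup>+g. (\<Sum>i. w i * indicator (T i s) g) \<partial>M)"
      unfolding F_def c_def T_def by (intro nn_integral_cong suminf_cong) (auto simp: indicator_def)
    also have "\<dots> = (\<Sum>i. w i * emeasure M (T i s))"
      by (subst nn_integral_suminf) (simp_all add: sets_M nn_integral_cmult_indicator)
    finally show ?thesis .
  qed
  have F_fin: "F s < \<infinity>" for s
  proof -
    have "F s \<le> (\<Sum>i. ennreal ((1/2) ^ Suc i))"
      unfolding F_eq by (intro suminf_le w_le) auto
    also have "\<dots> = ennreal 1"
      by (rule suminf_ennreal_eq) (use power_half_series in auto)
    finally show ?thesis by (rule order_le_less_trans) simp
  qed
  have F_pos: "0 < F s" for s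
  proof -
    obtain i where "s \<in> V i" using VL(4) by auto
    then have "0 \<in> T i s" by (simp add: T_def act_simps)
    then have "0 < w i * emeasure M (T i s)"
      using w_pos[of i] pos[OF T_open, of i s] by (auto simp: ennreal_zero_less_mult_iff)
    also have "\<dots> \<le> F s"
      unfolding F_eq using sum_le_suminf[of "\<lambda>i. w i * emeasure M (T i s)" "{i}"] by simp
    finally show ?thesis .
  qed
  have F_inv: "F (act h s) = F s" for h s
  proof -
    have "F (act h s) = (\<integral>\<^sup>+g. c (act (- (h + g)) (act h s)) \<partial>M)"
      unfolding F_def by (rule shift[symmetric]) (use act_measurable1 in measurable)
    also have "\<dots> = F s" unfolding F_def by (simp only: minus_add act_simps)
    finally show ?thesis .
  qed
  have F_measurable[measurable]: "F \<in> borel_measurable borel"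
    unfolding F_def by measurable
  define \<tau> where "\<tau> s = density M (\<lambda>g. c (act (- g) s) / F s)" for s
  have dens_measurable[measurable]: "(\<lambda>g. c (act (- g) s) / F s) \<in> borel_measurable borel" for s
    using act_measurable1[of s] by measurable
  have emeasure_\<tau>: "emeasure (\<tau> s) A = (\<integral>\<^sup>+g. c (act (- g) s) / F s * indicator A g \<partial>M)"
    if "A \<in> sets borel" for s A
    using that unfolding \<tau>_def by (intro emeasure_density) (auto simp: sets_M)
  have \<tau>_measurable: "\<tau> \<in> borel \<rightarrow>\<^sub>M prob_algebra borel"
  proof (rule measurable_prob_algebra_generated[where G = "sets borel" and \<Omega> = UNIV])
    show "sets borel = sigma_sets UNIV (sets (borel :: 'g measure))"
      using sets.sigma_sets_eq[of "borel :: 'g measure"] by simp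
    show "sets (\<tau> s) = sets borel" for s by (simp add: \<tau>_def sets_M)
    show "prob_space (\<tau> s)" for s
    proof
      have "emeasure (\<tau> s) UNIV = F s / F s"
        by (simp add: emeasure_\<tau> F_def) (subst nn_integral_divide, use act_measurable1 in measurable)
      then show "emeasure (\<tau> s) (space (\<tau> s)) = 1"
        using F_pos[of s] F_fin[of s] by (simp add: \<tau>_def space_M)
    qed
    show "(\<lambda>s. emeasure (\<tau> s) A) \<in> borel_measurable borel" if [measurable]: "A \<in> sets borel" for A
      by (simp add: emeasure_\<tau>) measurable
  qed (auto intro: sets.Int_stable)
  have "distr (\<tau> s) borel ((+) h) = \<tau> (act h s)" for h s
  proof (rule measure_eqI)
    show "sets (distr (\<tau> s) borel ((+) h)) = sets (\<tau> (act h s))" by (simp add: \<tau>_def sets_M)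
    fix A assume "A \<in> sets (distr (\<tau> s) borel ((+) h))"
    then have A[measurable]: "A \<in> sets borel" by simp
    have vA: "(+) h -` A \<in> sets borel" using measurable_sets[OF trans_measurable A] by simp
    have "emeasure (distr (\<tau> s) borel ((+) h)) A = emeasure (\<tau> s) ((+) h -` A)"
      by (subst emeasure_distr) (auto simp: \<tau>_def space_M sets_M)
    also have "\<dots> = (\<integral>\<^sup>+g. c (act (- (h + g)) (act h s)) / F (act h s) * indicator A (h + g) \<partial>M)"
      unfolding emeasure_\<tau>[OF vA] F_inv
      by (intro nn_integral_cong) (simp only: minus_add act_simps, simp add: indicator_def)
    also have "\<dots> = (\<integral>\<^sup>+g. c (act (- g) (act h s)) / F (act h s) * indicator A g \<partial>M)"
      by (rule shift) measurable
    also have "\<dots> = emeasure (\<tau> (act h s)) A" by (simp add: emeasure_\<tau>)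
    finally show "emeasure (distr (\<tau> s) borel ((+) h)) A = emeasure (\<tau> (act h s)) A" .
  qed
  then show ?thesis using \<tau>_measurable by blast
qed

section \<open>Norm-continuous families of Markov kernels\<close>

text \<open>
  Scheffe's lemma turns pointwise convergence of probability densities into convergence in total
  variation. Total variation convergence of kernels is expressed throughout by test functions that
  may vary with \<open>n\<close>, which amounts to taking the supremum over the unit ball.
\<close>

lemma densities_converge_in_norm:
  fixes q :: "nat \<Rightarrow> 'a \<Rightarrow> real"
  assumes [measurable]: "\<And>n. q n \<in> borel_measurable M" "r \<in> borel_measurable M"
      "\<And>n. f n \<in> borel_measurable M"
    and nonneg: "\<And>n t. 0 \<le> q n t" "\<And>t. 0 \<le> r t"
    and prob: "\<And>n. (\<integral>\<^sup>+t. ennreal (q n t) \<partial>M) = 1" "(\<integral>\<^sup>+t. ennreal (r t) \<partial>M) = 1"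
    and lim: "\<And>t. (\<lambda>n. q n t) \<longlonglongrightarrow> r t"
    and bounded: "\<And>n t. \<bar>f n t\<bar> \<le> (1::real)"
  shows "(\<lambda>n. (\<integral>t. f n t \<partial>density M (\<lambda>t. ennreal (q n t)))
            - (\<integral>t. f n t \<partial>density M (\<lambda>t. ennreal (r t)))) \<longlonglongrightarrow> 0"
    (is "?D \<longlonglongrightarrow> 0")
proof -
  have int_q: "integrable M (q n)" for n
    using nonneg prob by (intro integrableI_nonneg) auto
  have int_r: "integrable M r"
    using nonneg prob by (intro integrableI_nonneg) auto
  have L1: "(\<lambda>n. \<integral>\<^sup>+t. norm (q n t - r t) \<partial>M) \<longlonglongrightarrow> 0"
    by (rule Scheffe_lemma2) (use int_r lim nonneg prob in auto)
  have int_mult: "integrable M (\<lambda>t. p t * f n t)" if "integrable M p" for p n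
    using that by (rule Bochner_Integration.integrable_bound)
      (use that bounded in \<open>auto simp: abs_mult mult_left_le\<close>)
  have le: "ennreal \<bar>?D n\<bar> \<le> (\<integral>\<^sup>+t. norm (q n t - r t) \<partial>M)" for n
  proof -
    have "?D n = (\<integral>t. q n t * f n t \<partial>M) - (\<integral>t. r t * f n t \<partial>M)"
      using nonneg by (simp add: integral_density)
    also have "\<dots> = (\<integral>t. (q n t - r t) * f n t \<partial>M)"
      by (simp add: left_diff_distrib Bochner_Integration.integral_diff int_mult int_q int_r)
    finally have "ennreal \<bar>?D n\<bar> \<le> (\<integral>\<^sup>+t. norm ((q n t - r t) * f n t) \<partial>M)"
      using integral_norm_bound_ennreal[OF int_mult[of "\<lambda>t. q n t - r t" n]] int_q int_r by simp
    also have "\<dots> \<le> (\<integral>\<^sup>+t. norm (q n t - r t) \<partial>M)"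
      using bounded by (intro nn_integral_mono ennreal_leI) (auto simp: abs_mult mult_left_le)
    finally show ?thesis .
  qed
  have "(\<lambda>n. ennreal \<bar>?D n\<bar>) \<longlonglongrightarrow> 0"
    by (rule tendsto_sandwich[OF _ _ tendsto_const L1]) (use le in auto)
  then have "(\<lambda>n. \<bar>?D n\<bar>) \<longlonglongrightarrow> 0"
    by (subst (asm) ennreal_tendsto_0_iff) auto
  then show ?thesis by (rule tendsto_rabs_zero_cancel)
qed

definition bounded_by_one :: "('s::topological_space \<Rightarrow> real) \<Rightarrow> bool" where
  "bounded_by_one f \<longleftrightarrow> f \<in> borel_measurable borel \<and> (\<forall>t. \<bar>f t\<bar> \<le> 1)"

lemma bounded_by_oneD:
  assumes "bounded_by_one f" shows "f \<in> borel_measurable borel" "\<bar>f t\<bar> \<le> 1" "f t \<le> 1" "- 1 \<le> f t"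
  using assms by (auto simp: bounded_by_one_def abs_le_iff minus_le_iff)

lemma integral_bounded_by_one:
  assumes M: "M \<in> space (prob_algebra borel)" and f: "bounded_by_one f"
  shows "integrable M f" "\<bar>\<integral>t. f t \<partial>M\<bar> \<le> 1"
proof -
  interpret prob_space M using M by (simp add: space_prob_algebra)
  have [measurable_cong]: "sets M = sets borel" using M by (simp add: space_prob_algebra)
  have [measurable]: "f \<in> borel_measurable borel" using f by (rule bounded_by_oneD)
  show int: "integrable M f"
    using bounded_by_oneD(2)[OF f] by (intro integrable_const_bound[where B = 1]) auto
  show "\<bar>\<integral>t. f t \<partial>M\<bar> \<le> 1"
    using bounded_by_oneD[OF f] integral_le_const[OF int] integral_ge_const[OF int]
    by (simp add: abs_le_iff minus_le_iff)
qed

lemma bounded_by_one_kernel_integral: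
  assumes \<tau>: "\<tau> \<in> borel \<rightarrow>\<^sub>M prob_algebra borel" and f: "bounded_by_one f"
  shows "bounded_by_one (\<lambda>s. \<integral>t. f t \<partial>\<tau> s)"
  unfolding bounded_by_one_def
proof (intro conjI allI)
  have [measurable]: "f \<in> borel_measurable borel" using f by (rule bounded_by_oneD)
  show "(\<lambda>s. \<integral>t. f t \<partial>\<tau> s) \<in> borel_measurable borel"
    by (rule measurable_compose[OF measurable_prob_algebraD[OF \<tau>] integral_measurable_subprob_algebra]) fact
  show "\<bar>\<integral>t. f t \<partial>\<tau> s\<bar> \<le> 1" for s
    using measurable_space[OF \<tau>] by (intro integral_bounded_by_one f) simp
qed

text \<open>
  A countable product of intervals is sequentially compact, which replaces a diagonal argument.
\<close>

lemma pointwise_convergent_subsequence: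
  fixes g :: "nat \<Rightarrow> nat \<Rightarrow> real"
  assumes "\<And>n i. g n i \<in> {a i..b i}"
  obtains r where "strict_mono r" "\<And>i. convergent (\<lambda>n. g (r n) i)"
proof -
  have "seq_compact (\<Pi>\<^sub>E i\<in>UNIV. {a i..b i})"
    using compact_product_of_intervals by (rule compact_imp_seq_compact)
  moreover have "\<forall>n. g n \<in> (\<Pi>\<^sub>E i\<in>UNIV. {a i..b i})"
    using assms by (intro allI PiE_I) (blast, simp)
  ultimately obtain l r where r: "strict_mono r" "(g \<circ> r) \<longlonglongrightarrow> l"
    unfolding seq_compact_def by blast
  have "(\<lambda>n. (g \<circ> r) n i) \<longlonglongrightarrow> l i" for i
    by (rule continuous_on_tendsto_compose[OF continuous_on_product_coordinates r(2)]) auto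
  then have "convergent (\<lambda>n. g (r n) i)" for i by (auto simp: convergent_def)
  with r(1) show thesis by (rule that)
qed

text \<open>
  Letting the test functions \<open>f n\<close> vary makes the second assumption joint continuity of \<open>\<kappa>\<close> in
  total variation, without mentioning the norm.
\<close>

locale norm_continuous_kernels =
  fixes \<kappa> :: "'x::{second_countable_topology, t2_space} \<Rightarrow>
                's::{second_countable_topology, t2_space} \<Rightarrow> 's measure"
  assumes kernel: "\<kappa> x \<in> borel \<rightarrow>\<^sub>M prob_algebra borel"
    and norm_continuous: "X \<longlonglongrightarrow> x \<Longrightarrow> S \<longlonglongrightarrow> s \<Longrightarrow> (\<And>n. bounded_by_one (f n)) \<Longrightarrow>
      (\<lambda>n. markov_operator (\<kappa> (X n)) (f n) (S n) - markov_operator (\<kappa> x) (f n) s) \<longlonglongrightarrow> 0"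
begin

abbreviation "P x \<equiv> markov_operator (\<kappa> x)"

lemma prob_space_kernel: "prob_space (\<kappa> x s)" and sets_kernel [simp]: "sets (\<kappa> x s) = sets borel"
  using measurable_space[OF kernel, of s x] by (auto simp: space_prob_algebra)

lemma space_kernel [simp]: "space (\<kappa> x s) = UNIV"
  using sets_eq_imp_space_eq[OF sets_kernel] by simp

lemma integrable_kernel: "bounded_by_one f \<Longrightarrow> integrable (\<kappa> x s) f"
  using measurable_space[OF kernel, of s x] by (intro integral_bounded_by_one) auto

lemma bounded_by_one_P: "bounded_by_one f \<Longrightarrow> bounded_by_one (P x f)"
  unfolding markov_operator_def[abs_def] by (rule bounded_by_one_kernel_integral[OF kernel])

lemma bounded_by_one_iterate: "bounded_by_one f \<Longrightarrow> bounded_by_one ((P x ^^ k) f)"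
  by (induction k) (auto intro: bounded_by_one_P)

lemma P_average:
  assumes "\<And>k. bounded_by_one (g k)"
  shows "P x (\<lambda>t. (\<Sum>k\<le>n. g k t) / c) s = (\<Sum>k\<le>n. P x (g k) s) / c"
  unfolding markov_operator_def
  by (simp add: Bochner_Integration.integral_sum integrable_kernel assms)

text \<open>
  The average starts with the first power of \<open>P x\<close>: its value is then of the form \<open>P x w\<close> with
  \<open>w\<close> bounded by one, and inherits the regularity of the kernel in \<open>x\<close> and \<open>s\<close>, which \<open>f\<close> itself lacks.
\<close>

definition cesaro :: "nat \<Rightarrow> 'x \<Rightarrow> ('s \<Rightarrow> real) \<Rightarrow> 's \<Rightarrow> real" where
  "cesaro n x f s = (\<Sum>k\<le>n. (P x ^^ Suc k) f s) / Suc n"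

lemma bounded_by_one_average:
  assumes "\<And>k. bounded_by_one (g k)"
  shows "bounded_by_one (\<lambda>t. (\<Sum>k\<le>n. g k t) / real (Suc n))"
  unfolding bounded_by_one_def
proof (intro conjI allI)
  have [measurable]: "g k \<in> borel_measurable borel" for k using assms by (rule bounded_by_oneD)
  show "(\<lambda>t. (\<Sum>k\<le>n. g k t) / real (Suc n)) \<in> borel_measurable borel" by measurable
  fix t
  have "\<bar>\<Sum>k\<le>n. g k t\<bar> \<le> (\<Sum>k\<le>n. \<bar>g k t\<bar>)" by (rule sum_abs)
  also have "\<dots> \<le> (\<Sum>k\<le>n. 1)" using bounded_by_oneD[OF assms] by (intro sum_mono)
  finally show "\<bar>(\<Sum>k\<le>n. g k t) / real (Suc n)\<bar> \<le> 1" by (simp add: divide_le_eq)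
qed

lemma cesaro_eq_P:
  assumes "bounded_by_one f"
  shows "cesaro n x f = P x (\<lambda>t. (\<Sum>k\<le>n. (P x ^^ k) f t) / Suc n)"
  by (rule ext, subst P_average) (simp_all add: cesaro_def bounded_by_one_iterate assms)

text \<open>
  The difference telescopes, leaving two terms of absolute value at most one.
\<close>

lemma cesaro_almost_harmonic:
  assumes "bounded_by_one f"
  shows "\<bar>P x (cesaro n x f) s - cesaro n x f s\<bar> \<le> 2 / Suc n"
proof -
  have "P x (cesaro n x f) s = (\<Sum>k\<le>n. (P x ^^ Suc (Suc k)) f s) / Suc n"
    unfolding cesaro_def[abs_def]
    by (subst P_average[where g = "\<lambda>k. (P x ^^ Suc k) f", OF bounded_by_one_iterate[OF assms]]) simp
  then have "P x (cesaro n x f) s - cesaro n x f s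
      = (\<Sum>k\<le>n. (P x ^^ Suc (Suc k)) f s - (P x ^^ Suc k) f s) / Suc n"
    by (simp only: cesaro_def sum_subtractf diff_divide_distrib)
  also have "(\<Sum>k\<le>n. (P x ^^ Suc (Suc k)) f s - (P x ^^ Suc k) f s)
      = (P x ^^ Suc (Suc n)) f s - (P x ^^ Suc 0) f s"
    using sum_telescope[of "\<lambda>k. - (P x ^^ Suc k) f s" n] by (simp add: atMost_atLeast0)
  finally have eq: "P x (cesaro n x f) s - cesaro n x f s
      = ((P x ^^ Suc (Suc n)) f s - (P x ^^ Suc 0) f s) / Suc n" .
  have "\<bar>(P x ^^ k) f s\<bar> \<le> 1" for k
    by (rule bounded_by_oneD(2)[OF bounded_by_one_iterate[OF assms]])
  from this[of "Suc (Suc n)"] this[of "Suc 0"]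
  have "\<bar>(P x ^^ Suc (Suc n)) f s - (P x ^^ Suc 0) f s\<bar> \<le> 2" by linarith
  then have "\<bar>(P x ^^ Suc (Suc n)) f s - (P x ^^ Suc 0) f s\<bar> / real (Suc n) \<le> 2 / Suc n"
    by (rule divide_right_mono) simp
  then show ?thesis unfolding eq abs_divide by simp
qed

definition sequentially_continuous :: "('x \<Rightarrow> 's \<Rightarrow> real) \<Rightarrow> bool" where
  "sequentially_continuous F \<longleftrightarrow>
     (\<forall>X x S s. X \<longlonglongrightarrow> x \<longrightarrow> S \<longlonglongrightarrow> s \<longrightarrow> (\<lambda>n. F (X n) (S n)) \<longlonglongrightarrow> F x s)"

lemma P_bounded_convergence:
  assumes "\<And>n. bounded_by_one (f n)" "bounded_by_one g" "\<And>t. (\<lambda>n. f n t) \<longlonglongrightarrow> g t"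
  shows "(\<lambda>n. P x (f n) s) \<longlonglongrightarrow> P x g s"
  unfolding markov_operator_def
proof (rule integral_dominated_convergence[where w = "\<lambda>_. 1"])
  interpret prob_space "\<kappa> x s" by (rule prob_space_kernel)
  show "integrable (\<kappa> x s) (\<lambda>_. 1)" by simp
qed (use assms bounded_by_oneD[OF assms(1)] bounded_by_oneD[OF assms(2)] in
    \<open>auto cong: measurable_cong_sets\<close>)

lemma sequentially_continuous_P:
  assumes "\<And>x. bounded_by_one (F x)" "\<And>t X x. X \<longlonglongrightarrow> x \<Longrightarrow> (\<lambda>n. F (X n) t) \<longlonglongrightarrow> F x t"
  shows "sequentially_continuous (\<lambda>x. P x (F x))"
  unfolding sequentially_continuous_def
proof (intro allI impI)
  fix X and x :: 'x and S and s :: 's assume lim: "X \<longlonglongrightarrow> x" "S \<longlonglongrightarrow> s"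
  have "(\<lambda>n. P (X n) (F (X n)) (S n) - P x (F (X n)) s) \<longlonglongrightarrow> 0"
    using lim assms(1) by (rule norm_continuous)
  moreover have "(\<lambda>n. P x (F (X n)) s) \<longlonglongrightarrow> P x (F x) s"
    by (intro P_bounded_convergence assms lim)
  ultimately show "(\<lambda>n. P (X n) (F (X n)) (S n)) \<longlonglongrightarrow> P x (F x) s"
    using Lim_transform by fastforce
qed

lemma sequentially_continuous_iterate:
  assumes "bounded_by_one f"
  shows "sequentially_continuous (\<lambda>x. (P x ^^ Suc k) f)"
proof (induction k)
  case 0
  show ?case
    using sequentially_continuous_P[of "\<lambda>_. f"] assms by (simp add: tendsto_const)
next
  case (Suc k)
  have "sequentially_continuous (\<lambda>x. P x ((P x ^^ Suc k) f))"
  proof (rule sequentially_continuous_P)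
    show "bounded_by_one ((P x ^^ Suc k) f)" for x by (rule bounded_by_one_iterate[OF assms])
    show "(\<lambda>n. (P (X n) ^^ Suc k) f t) \<longlonglongrightarrow> (P x ^^ Suc k) f t" if "X \<longlonglongrightarrow> x" for t X x
      using Suc that tendsto_const[of t] unfolding sequentially_continuous_def by blast
  qed
  then show ?case by simp
qed

lemma continuous_on_cesaro:
  assumes "bounded_by_one f"
  shows "continuous_on UNIV (\<lambda>x. cesaro n x f s)"
proof (rule continuous_on_sequentiallyI)
  fix X and x :: 'x assume "X \<longlonglongrightarrow> x"
  then have "(\<lambda>i. (P (X i) ^^ Suc k) f s) \<longlonglongrightarrow> (P x ^^ Suc k) f s" for k
    using sequentially_continuous_iterate[OF assms, of k] tendsto_const[of s]
    unfolding sequentially_continuous_def by blast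
  then show "(\<lambda>i. cesaro n (X i) f s) \<longlonglongrightarrow> cesaro n x f s"
    unfolding cesaro_def by (intro tendsto_intros) auto
qed

text \<open>
  If no point of \<open>D\<close> worked, points \<open>d n\<close> of \<open>D\<close> tending to \<open>s\<close> and test functions witnessing their
  failure would contradict continuity in total variation.
\<close>

lemma P_equicontinuous:
  assumes dense: "\<And>U. open U \<Longrightarrow> U \<noteq> {} \<Longrightarrow> \<exists>d\<in>D. d \<in> U" and "0 < \<epsilon>"
  obtains d where "d \<in> D" "\<And>w. bounded_by_one w \<Longrightarrow> \<bar>P x w d - P x w s\<bar> < \<epsilon>"
proof -
  have "s \<in> closure D"
  proof (rule ccontr)
    assume "s \<notin> closure D"
    then obtain d where "d \<in> D" "d \<in> - closure D"
      using dense[of "- closure D"] by auto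
    then show False using closure_subset[of D] by auto
  qed
  then obtain d where d: "\<And>n. d n \<in> D" "d \<longlonglongrightarrow> s" unfolding closure_sequential by blast
  have "\<exists>n. \<forall>w. bounded_by_one w \<longrightarrow> \<bar>P x w (d n) - P x w s\<bar> < \<epsilon>"
  proof (rule ccontr)
    assume "\<not> ?thesis"
    then obtain w where w: "\<And>n. bounded_by_one (w n)" "\<And>n. \<epsilon> \<le> \<bar>P x (w n) (d n) - P x (w n) s\<bar>"
      unfolding not_ex not_all not_imp not_less by metis
    have "(\<lambda>n. P x (w n) (d n) - P x (w n) s) \<longlonglongrightarrow> 0"
      by (rule norm_continuous) (use d w in auto)
    then have "(\<lambda>n. \<bar>P x (w n) (d n) - P x (w n) s\<bar>) \<longlonglongrightarrow> 0" by (rule tendsto_rabs_zero)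
    then have "\<epsilon> \<le> 0" by (rule tendsto_lowerbound) (use w in auto)
    then show False using \<open>0 < \<epsilon>\<close> by simp
  qed
  then show thesis using that d by blast
qed

text \<open>
  The argument of the Arzela-Ascoli theorem: convergence on a countable dense set extends to
  all points by equicontinuity.
\<close>

lemma P_convergent_subsequence:
  fixes w :: "nat \<Rightarrow> 's \<Rightarrow> real"
  assumes w: "\<And>n. bounded_by_one (w n)"
  obtains r h where "strict_mono r" "bounded_by_one h" "\<And>s. (\<lambda>n. P x (w (r n)) s) \<longlonglongrightarrow> h s"
proof -
  obtain D :: "'s set" where D: "countable D" "\<And>U. open U \<Longrightarrow> U \<noteq> {} \<Longrightarrow> \<exists>d\<in>D. d \<in> U"
    using countable_dense_exists by blast
  have "D \<noteq> {}" using D(2)[of UNIV] by auto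
  obtain r where r: "strict_mono r" "\<And>i. convergent (\<lambda>n. P x (w (r n)) (from_nat_into D i))"
    by (rule pointwise_convergent_subsequence[of "\<lambda>n i. P x (w n) (from_nat_into D i)" "\<lambda>_. - 1" "\<lambda>_. 1"])
       (use bounded_by_oneD(3,4)[OF bounded_by_one_P[OF w]] in auto)
  have conv_D: "Cauchy (\<lambda>n. P x (w (r n)) d)" if "d \<in> D" for d
    using r(2) from_nat_into_surj[OF D(1) that] by (metis convergent_Cauchy)
  have "Cauchy (\<lambda>n. P x (w (r n)) s)" for s
  proof (rule CauchyI)
    fix e :: real assume "0 < e"
    then obtain d where d: "d \<in> D" "\<And>w. bounded_by_one w \<Longrightarrow> \<bar>P x w d - P x w s\<bar> < e / 3"
      using P_equicontinuous[OF D(2), where \<epsilon> = "e / 3"] by (metis divide_pos_pos zero_less_numeral)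
    obtain M where M: "\<And>m n. m \<ge> M \<Longrightarrow> n \<ge> M \<Longrightarrow> norm (P x (w (r m)) d - P x (w (r n)) d) < e / 3"
      using CauchyD[OF conv_D[OF d(1)], of "e / 3"] \<open>0 < e\<close> by auto
    have "norm (P x (w (r m)) s - P x (w (r n)) s) < e" if "m \<ge> M" "n \<ge> M" for m n
      using M[OF that] d(2)[OF w, of "r m"] d(2)[OF w, of "r n"] unfolding real_norm_def by linarith
    then show "\<exists>M. \<forall>m\<ge>M. \<forall>n\<ge>M. norm (P x (w (r m)) s - P x (w (r n)) s) < e" by blast
  qed
  then have "\<forall>s. \<exists>l. (\<lambda>n. P x (w (r n)) s) \<longlonglongrightarrow> l"
    by (auto simp: Cauchy_convergent_iff convergent_def)
  then obtain h where h: "\<And>s. (\<lambda>n. P x (w (r n)) s) \<longlonglongrightarrow> h s" by metis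
  have "bounded_by_one h"
    unfolding bounded_by_one_def
  proof (intro conjI allI)
    show "h \<in> borel_measurable borel"
      by (rule borel_measurable_LIMSEQ_real[OF h]) (use bounded_by_oneD(1)[OF bounded_by_one_P[OF w]] in auto)
    show "\<bar>h t\<bar> \<le> 1" for t
      by (rule tendsto_upperbound[OF tendsto_rabs[OF h]])
         (use bounded_by_oneD(2)[OF bounded_by_one_P[OF w]] in auto)
  qed
  with r(1) h show thesis by (metis that)
qed

text \<open>
  The kernels \<open>P (X n)\<close> may be replaced by \<open>P x\<close> up to a vanishing error. Hence a pointwise limit of
  the functions \<open>P (X n) (w n)\<close> exists along a subsequence and is harmonic for \<open>P x\<close>, so it is
  constant, and the convergence to it holds even at the moving points \<open>S n\<close> and \<open>S' n\<close>.
\<close>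

lemma almost_harmonic_asymptotically_constant:
  assumes liouville: "\<And>h. bounded_by_one h \<Longrightarrow> P x h = h \<Longrightarrow> \<exists>c. \<forall>s. h s = c"
    and lim: "X \<longlonglongrightarrow> x" "S \<longlonglongrightarrow> s" "S' \<longlonglongrightarrow> s'"
    and w: "\<And>n. bounded_by_one (w n)"
    and almost: "\<And>t. (\<lambda>n. P (X n) (P (X n) (w n)) t - P (X n) (w n) t) \<longlonglongrightarrow> 0"
  obtains r where "strict_mono r"
    "(\<lambda>n. P (X (r n)) (w (r n)) (S (r n)) - P (X (r n)) (w (r n)) (S' (r n))) \<longlonglongrightarrow> 0"
proof -
  obtain r h where r: "strict_mono r" and h: "bounded_by_one h"
    and w_h: "\<And>t. (\<lambda>n. P x (w (r n)) t) \<longlonglongrightarrow> h t"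
    using P_convergent_subsequence[where w = w, OF w] by metis
  have X_r: "(\<lambda>n. X (r n)) \<longlonglongrightarrow> x" and S_r: "(\<lambda>n. S (r n)) \<longlonglongrightarrow> s" "(\<lambda>n. S' (r n)) \<longlonglongrightarrow> s'"
    using lim LIMSEQ_subseq_LIMSEQ[OF _ r] by (auto simp: o_def)
  have to_h: "(\<lambda>n. P (X (r n)) (w (r n)) (T n)) \<longlonglongrightarrow> h t" if T: "T \<longlonglongrightarrow> t" for T t
  proof -
    have "(\<lambda>n. P (X (r n)) (w (r n)) (T n) - P x (w (r n)) t) \<longlonglongrightarrow> 0"
      by (rule norm_continuous[OF X_r T]) (rule w)
    from tendsto_add[OF this w_h[of t]] show ?thesis by simp
  qed
  have "P x h t = h t" for t
  proof -
    let ?g = "\<lambda>n. P (X (r n)) (w (r n))"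
    have "(\<lambda>n. P x (?g n) t) \<longlonglongrightarrow> P x h t"
      by (intro P_bounded_convergence h bounded_by_one_P w to_h tendsto_const)
    moreover have "(\<lambda>n. P (X (r n)) (?g n) t - P x (?g n) t) \<longlonglongrightarrow> 0"
      by (intro norm_continuous X_r tendsto_const bounded_by_one_P w)
    ultimately have "(\<lambda>n. P (X (r n)) (?g n) t) \<longlonglongrightarrow> P x h t"
      using tendsto_add by fastforce
    moreover have "(\<lambda>n. P (X (r n)) (?g n) t - ?g n t) \<longlonglongrightarrow> 0"
      using LIMSEQ_subseq_LIMSEQ[OF almost[of t] r] by (simp add: o_def)
    ultimately have "(\<lambda>n. ?g n t) \<longlonglongrightarrow> P x h t"
      using tendsto_diff by fastforce
    then show ?thesis by (rule LIMSEQ_unique[OF _ to_h[OF tendsto_const]])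
  qed
  then obtain c where "\<And>t. h t = c" using liouville[OF h] by blast
  then have "(\<lambda>n. P (X (r n)) (w (r n)) (S (r n)) - P (X (r n)) (w (r n)) (S' (r n))) \<longlonglongrightarrow> 0"
    using tendsto_diff[OF to_h[OF S_r(1)] to_h[OF S_r(2)]] by simp
  with r show thesis by (rule that)
qed

text \<open>
  This form, with sequences of parameters, points and test functions, encodes convergence that is
  uniform on compact sets and in total variation.
\<close>

lemma cesaro_asymptotically_constant:
  assumes "\<And>h. bounded_by_one h \<Longrightarrow> P x h = h \<Longrightarrow> \<exists>c. \<forall>s. h s = c"
    and "X \<longlonglongrightarrow> x" "S \<longlonglongrightarrow> s" "S' \<longlonglongrightarrow> s'"
    and f: "\<And>n. bounded_by_one (f n)" and N: "filterlim N at_top sequentially"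
  obtains r where "strict_mono r"
    "(\<lambda>n. cesaro (N (r n)) (X (r n)) (f (r n)) (S (r n))
        - cesaro (N (r n)) (X (r n)) (f (r n)) (S' (r n))) \<longlonglongrightarrow> 0"
proof -
  define w where "w n t = (\<Sum>k\<le>N n. (P (X n) ^^ k) (f n) t) / Suc (N n)" for n t
  have w: "bounded_by_one (w n)" for n
    unfolding w_def[abs_def] by (intro bounded_by_one_average bounded_by_one_iterate f)
  have P_w: "P (X n) (w n) = cesaro (N n) (X n) (f n)" for n
    unfolding w_def[abs_def] by (rule cesaro_eq_P[OF f, symmetric])
  have bound_lim: "(\<lambda>n. 2 / Suc (N n)) \<longlonglongrightarrow> 0"
    using filterlim_compose[OF LIMSEQ_Suc[OF lim_const_over_n[of "2::real"]] N] by simp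
  have "(\<lambda>n. P (X n) (P (X n) (w n)) t - P (X n) (w n) t) \<longlonglongrightarrow> 0" for t
    by (rule Lim_null_comparison[OF _ bound_lim])
       (use cesaro_almost_harmonic[OF f] in \<open>simp add: P_w\<close>)
  from almost_harmonic_asymptotically_constant[OF assms(1-4) w this]
  show thesis using that unfolding P_w by blast
qed

end

section \<open>Topological amenability from the Liouville property\<close>

lemma integral_bind_kernel:
  assumes M: "M \<in> space (prob_algebra borel)" and \<tau>: "\<tau> \<in> borel \<rightarrow>\<^sub>M prob_algebra borel"
    and f: "bounded_by_one f"
  shows "(\<integral>t. f t \<partial>(M \<bind> \<tau>)) = (\<integral>s. (\<integral>t. f t \<partial>\<tau> s) \<partial>M)"
proof (rule integral_bind[where K = borel and B = 1 and B' = 1])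
  have sets_M[measurable_cong]: "sets M = sets borel" and "prob_space M"
    using M by (auto simp: space_prob_algebra)
  then show "finite_measure M" by (simp add: prob_space_def)
  show "\<tau> \<in> M \<rightarrow>\<^sub>M subprob_algebra borel"
    using measurable_prob_algebraD[OF \<tau>] by measurable
  have "prob_space (\<tau> s)" for s
    using measurable_space[OF \<tau>, of s] by (simp add: space_prob_algebra)
  then show "AE s in M. emeasure (\<tau> s) (space (\<tau> s)) \<le> ennreal 1"
    by (simp add: prob_space.emeasure_space_1)
qed (use bounded_by_oneD[OF f] in auto)

lemma bind_in_prob_algebra:
  "M \<in> space (prob_algebra A) \<Longrightarrow> \<tau> \<in> A \<rightarrow>\<^sub>M prob_algebra B \<Longrightarrow> M \<bind> \<tau> \<in> space (prob_algebra B)"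
  by (simp add: space_prob_algebra prob_space_bind' sets_bind')

text \<open>
  For a finite partition the sum of the absolute values is the difference of the integrals of a
  single function, the signed sum of the indicators of the blocks. The lower bound comes from the
  one-block partition, once the upper bound shows that the supremum is over a bounded set.
\<close>

lemma tv_norm_diff_bounds:
  fixes M N :: "'a::topological_space measure"
  assumes M: "M \<in> space (prob_algebra borel)" and N: "N \<in> space (prob_algebra borel)"
    and le: "\<And>F. bounded_by_one F \<Longrightarrow> \<bar>(\<integral>t. F t \<partial>M) - (\<integral>t. F t \<partial>N)\<bar> \<le> e"
  shows "tv_norm (\<lambda>A. measure M A - measure N A) \<in> {0..e}"
proof -
  let ?Q = "{\<P>. finite \<P> \<and> \<P> \<subseteq> sets (borel :: 'a measure) \<and> partition_on UNIV \<P>}"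
  let ?v = "\<lambda>A. measure M A - measure N A"
  interpret M: prob_space M using M by (simp add: space_prob_algebra)
  interpret N: prob_space N using N by (simp add: space_prob_algebra)
  have sets[measurable_cong]: "sets M = sets borel" "sets N = sets borel"
    using M N by (auto simp: space_prob_algebra)
  have space: "space M = UNIV" "space N = UNIV" using sets[THEN sets_eq_imp_space_eq] by auto
  have sum_le: "(\<Sum>A\<in>\<P>. \<bar>?v A\<bar>) \<le> e" if \<P>: "\<P> \<in> ?Q" for \<P>
  proof -
    have fin: "finite \<P>" and meas: "\<And>A. A \<in> \<P> \<Longrightarrow> A \<in> sets borel" and disj: "disjoint \<P>"
      using \<P> by (auto simp: partition_on_def)
    define F where "F t = (\<Sum>A\<in>\<P>. sgn (?v A) * indicator A t)" for t :: 'a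
    have "bounded_by_one F"
      unfolding bounded_by_one_def
    proof (intro conjI allI)
      show "F \<in> borel_measurable borel"
        unfolding F_def using meas by (intro borel_measurable_sum) auto
      fix t
      have "\<bar>F t\<bar> \<le> (\<Sum>A\<in>\<P>. \<bar>sgn (?v A) * indicator A t\<bar>)" unfolding F_def by (rule sum_abs)
      also have "\<dots> \<le> (\<Sum>A\<in>\<P>. indicator A t)"
        by (intro sum_mono) (auto simp: indicator_def sgn_if)
      also have "\<dots> = (indicator (\<Union>A\<in>\<P>. A) t :: real)"
        using fin disj
        by (intro indicator_UN_disjoint[symmetric])
           (auto simp: disjoint_family_on_def pairwise_def disjnt_def)
      also have "\<dots> \<le> 1" by (simp add: indicator_def)
      finally show "\<bar>F t\<bar> \<le> 1" .
    qed
    note le[OF this]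
    moreover have "(\<integral>t. F t \<partial>M) = (\<Sum>A\<in>\<P>. sgn (?v A) * measure M A)"
      unfolding F_def using meas sets
      by (subst Bochner_Integration.integral_sum) (auto simp: space M.emeasure_finite less_top[symmetric])
    moreover have "(\<integral>t. F t \<partial>N) = (\<Sum>A\<in>\<P>. sgn (?v A) * measure N A)"
      unfolding F_def using meas sets
      by (subst Bochner_Integration.integral_sum) (auto simp: space N.emeasure_finite less_top[symmetric])
    ultimately have "\<bar>\<Sum>A\<in>\<P>. sgn (?v A) * ?v A\<bar> \<le> e"
      by (simp add: sum_subtractf right_diff_distrib)
    moreover have "(\<Sum>A\<in>\<P>. sgn (?v A) * ?v A) = (\<Sum>A\<in>\<P>. \<bar>?v A\<bar>)"
      by (intro sum.cong) (auto simp: sgn_if)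
    ultimately show ?thesis by linarith
  qed
  have trivial: "{UNIV} \<in> ?Q" by (auto simp: partition_on_def)
  have "tv_norm ?v \<le> e"
    unfolding tv_norm_def using trivial sum_le by (intro cSUP_least) blast+
  moreover have "(\<Sum>A\<in>{UNIV}. \<bar>?v A\<bar>) \<le> tv_norm ?v"
    unfolding tv_norm_def by (rule cSUP_upper[OF trivial]) (use sum_le in \<open>auto simp: bdd_above_def\<close>)
  ultimately show ?thesis by auto
qed

context norm_continuous_kernels
begin

primrec steps :: "nat \<Rightarrow> 'x \<Rightarrow> 's \<Rightarrow> 's measure" where
  "steps 0 = \<kappa>"
| "steps (Suc k) = (\<lambda>x s. \<kappa> x s \<bind> steps k x)"

lemma steps_measurable: "steps k x \<in> borel \<rightarrow>\<^sub>M prob_algebra borel"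
  by (induction k) (simp_all add: kernel measurable_bind_prob_space[OF kernel])

lemma integral_steps: "bounded_by_one f \<Longrightarrow> (\<integral>t. f t \<partial>steps k x s) = (P x ^^ Suc k) f s"
proof (induction k arbitrary: s)
  case (Suc k)
  have "(\<integral>t. f t \<partial>steps (Suc k) x s) = P x (markov_operator (steps k x) f) s"
    using integral_bind_kernel[OF _ steps_measurable Suc.prems, of "\<kappa> x s"]
      measurable_space[OF kernel] by (simp add: markov_operator_def)
  also have "markov_operator (steps k x) f = (P x ^^ Suc k) f"
    unfolding markov_operator_def[of "steps k x"] using Suc by (intro ext) simp
  finally show ?case by simp
qed (simp add: markov_operator_def)

text \<open>
  The distribution of the chain after a uniformly random number of steps between \<open>1\<close> and \<open>n + 1\<close>,
  written as a mixture in order to be a measure.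
\<close>

definition cesaro_measure :: "nat \<Rightarrow> 'x \<Rightarrow> 's \<Rightarrow> 's measure" where
  "cesaro_measure n x s = measure_pmf (pmf_of_set {..n}) \<bind> (\<lambda>k. steps k x s)"

lemma steps_measurable_time: "(\<lambda>k. steps k x s) \<in> count_space UNIV \<rightarrow>\<^sub>M prob_algebra borel"
  using measurable_space[OF steps_measurable] by simp

lemma measure_pmf_in_prob_algebra: "measure_pmf p \<in> space (prob_algebra (count_space UNIV))"
  by (simp add: space_prob_algebra measure_pmf.prob_space_axioms)

lemma cesaro_measure_in_prob_algebra: "cesaro_measure n x s \<in> space (prob_algebra borel)"
  unfolding cesaro_measure_def
  by (rule bind_in_prob_algebra[OF measure_pmf_in_prob_algebra steps_measurable_time])

lemma integral_cesaro_measure: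
  assumes f: "bounded_by_one f"
  shows "(\<integral>t. f t \<partial>cesaro_measure n x s) = cesaro n x f s"
proof -
  have "prob_space (steps k x s)" for k
    using measurable_space[OF steps_measurable, of s] by (simp add: space_prob_algebra)
  then have "(\<integral>t. f t \<partial>cesaro_measure n x s) = (\<integral>k. (\<integral>t. f t \<partial>steps k x s) \<partial>measure_pmf (pmf_of_set {..n}))"
    unfolding cesaro_measure_def using bounded_by_oneD[OF f]
      measurable_prob_algebraD[OF steps_measurable_time]
    by (intro integral_bind[where K = borel and B = 1 and B' = 1])
       (auto simp: prob_space.emeasure_space_1 measure_pmf.finite_measure_axioms)
  also have "\<dots> = cesaro n x f s"
    by (subst integral_pmf_of_set) (auto simp: integral_steps[OF f] cesaro_def)
  finally show ?thesis .
qed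

lemma cesaro_equivariant:
  assumes [measurable]: "a \<in> borel_measurable borel"
    and equivariant: "\<And>s. \<kappa> y (a s) = distr (\<kappa> x s) borel a" and f: "bounded_by_one f"
  shows "cesaro n y f (a s) = cesaro n x (f \<circ> a) s"
proof -
  have P_eq: "P y h (a s) = P x (h \<circ> a) s" if "bounded_by_one h" for h s
    unfolding markov_operator_def equivariant
    using bounded_by_oneD(1)[OF that] by (subst integral_distr) (auto simp: comp_def cong: measurable_cong_sets)
  have "(P y ^^ k) f (a s) = (P x ^^ k) (f \<circ> a) s" for k s
  proof (induction k arbitrary: s)
    case (Suc k)
    have "(P y ^^ k) f \<circ> a = (P x ^^ k) (f \<circ> a)" by (rule ext, subst comp_apply) (rule Suc)
    then show ?case
      using P_eq[OF bounded_by_one_iterate[OF f, of k y]] by (simp add: comp_def)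
  qed simp
  then show ?thesis unfolding cesaro_def by (simp only:)
qed

text \<open>
  Translating \<open>\<theta> n x\<close> by \<open>g\<close> gives the measure built like \<open>\<theta> n (actX g x)\<close> but with the chain
  started at \<open>actS g s0\<close> in place of \<open>s0\<close>. If the total variation distance did not tend to \<open>0\<close>
  uniformly on a compact set, a convergent subsequence of the offending pairs \<open>(g, x)\<close>, together
  with almost optimal test functions, would contradict \<open>cesaro_asymptotically_constant\<close>.
\<close>

theorem topologically_amenable_if_liouville:
  fixes actS :: "'g::{topological_group_add, second_countable_topology, t2_space} \<Rightarrow> 's \<Rightarrow> 's"
    and actX :: "'g \<Rightarrow> 'x \<Rightarrow> 'x"
  assumes lcG: "locally_compact_space (euclidean :: 'g topology)"
    and lcS: "locally_compact_space (euclidean :: 's topology)"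
    and actS: "continuous_action actS" "proper_action actS" and actX: "continuous_action actX"
    and equivariant: "\<And>g x s. \<kappa> (actX g x) (actS g s) = distr (\<kappa> x s) borel (actS g)"
    and liouville: "\<And>x h. bounded_by_one h \<Longrightarrow> P x h = h \<Longrightarrow> \<exists>c. \<forall>s. h s = c"
  shows "topologically_amenable actX"
proof -
  obtain \<tau> :: "'s \<Rightarrow> 'g measure" where \<tau>: "\<tau> \<in> borel \<rightarrow>\<^sub>M prob_algebra borel"
      and \<tau>_equiv: "\<And>g s. distr (\<tau> s) borel ((+) g) = \<tau> (actS g s)"
    using exists_equivariant_kernel_of_proper_action[OF lcG lcS actS] by blast
  define T where "T f s = (\<integral>h. f h \<partial>\<tau> s)" for f :: "'g \<Rightarrow> real" and s
  have bounded_by_one_T: "bounded_by_one (T f)" if "bounded_by_one f" for f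
    unfolding T_def[abs_def] by (rule bounded_by_one_kernel_integral[OF \<tau> that])
  define s0 where "s0 = (undefined :: 's)"
  define \<theta> where "\<theta> n x = cesaro_measure n x s0 \<bind> \<tau>" for n x
  have \<theta>_prob: "\<theta> n x \<in> space (prob_algebra borel)" for n x
    unfolding \<theta>_def by (rule bind_in_prob_algebra[OF cesaro_measure_in_prob_algebra \<tau>])
  have integral_\<theta>: "(\<integral>h. f h \<partial>\<theta> n x) = cesaro n x (T f) s0"
    if "bounded_by_one f" for f n x
    unfolding \<theta>_def
    by (simp add: integral_bind_kernel[OF cesaro_measure_in_prob_algebra \<tau> that]
        integral_cesaro_measure bounded_by_one_T[OF that] flip: T_def)
  have [measurable]: "(+) g \<in> borel_measurable borel" for g :: 'g
    by (intro borel_measurable_continuous_onI continuous_intros)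
  have actS_measurable: "actS g \<in> borel_measurable borel" for g
    by (intro borel_measurable_continuous_onI continuous_on_action[OF actS(1)] continuous_intros)
  have translate_prob: "distr (\<theta> n x) borel ((+) g) \<in> space (prob_algebra borel)" for n x g
    using \<theta>_prob[of n x]
    by (auto simp: space_prob_algebra intro!: prob_space.prob_space_distr cong: measurable_cong_sets)
  have integral_translate: "(\<integral>h. F h \<partial>distr (\<theta> n x) borel ((+) g))
      = cesaro n (actX g x) (T F) (actS g s0)" if F: "bounded_by_one F" for F n x g
  proof -
    have [measurable]: "F \<in> borel_measurable borel" using F by (rule bounded_by_oneD)
    have F': "bounded_by_one (\<lambda>h. F (g + h))"
      using bounded_by_oneD(2)[OF F] by (auto simp: bounded_by_one_def)
    have sets: "sets (\<theta> n x) = sets borel" "\<And>s. sets (\<tau> s) = sets borel"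
      using \<theta>_prob[of n x] measurable_space[OF \<tau>] by (auto simp: space_prob_algebra)
    have "(\<integral>h. F h \<partial>distr (\<theta> n x) borel ((+) g)) = (\<integral>h. F (g + h) \<partial>\<theta> n x)"
      by (rule integral_distr) (auto cong: measurable_cong_sets simp: sets)
    also have "\<dots> = cesaro n x (T (\<lambda>h. F (g + h))) s0" by (rule integral_\<theta>[OF F'])
    also have "T (\<lambda>h. F (g + h)) = T F \<circ> actS g"
      unfolding T_def comp_def \<tau>_equiv[symmetric]
      by (rule ext, subst integral_distr) (auto cong: measurable_cong_sets simp: sets)
    also have "cesaro n x (T F \<circ> actS g) s0
        = cesaro n (actX g x) (T F) (actS g s0)"
      by (rule cesaro_equivariant[symmetric])
         (use actS_measurable equivariant bounded_by_one_T[OF F] in auto)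
    finally show ?thesis .
  qed
  show ?thesis
    unfolding topologically_amenable_def
  proof (intro exI[of _ \<theta>] conjI allI impI)
    show "\<theta> n x \<in> space (prob_algebra borel)" for n x by (rule \<theta>_prob)
    show "weak_star_continuous (\<theta> n)" for n
      unfolding weak_star_continuous_def
    proof (intro allI impI, elim conjE)
      fix f :: "'g \<Rightarrow> real"
      assume f: "continuous_on UNIV f" "vanishes_at_infinity f"
      have "compact (f ` {x. 1 \<le> \<bar>f x\<bar>})"
        using f by (intro compact_continuous_image) (auto simp: vanishes_at_infinity_def intro: continuous_on_subset)
      then have "bounded (f ` {x. 1 \<le> \<bar>f x\<bar>})" by (rule compact_imp_bounded)
      then obtain C where "\<forall>y\<in>f ` {x. 1 \<le> \<bar>f x\<bar>}. norm y \<le> C" unfolding bounded_iff ..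
      then have C: "\<And>x. 1 \<le> \<bar>f x\<bar> \<Longrightarrow> \<bar>f x\<bar> \<le> C"
        by simp
      \<comment> \<open>Functions vanishing at infinity are bounded, and rescaling brings them below one.\<close>
      define B where "B = max 1 C"
      have B: "0 < B" "\<bar>f x\<bar> \<le> B" for x
        using C[of x] unfolding B_def by linarith+
      then have bound: "bounded_by_one (\<lambda>x. f x / B)"
        using borel_measurable_continuous_onI[OF f(1)] by (auto simp: bounded_by_one_def divide_le_eq)
      have "(\<integral>h. f h \<partial>\<theta> n x) = B * cesaro n x (T (\<lambda>x. f x / B)) s0" for x
        using B(1) by (simp add: integral_\<theta>[OF bound, symmetric])
      then show "continuous_on UNIV (\<lambda>x. \<integral>h. f h \<partial>\<theta> n x)"
        by (simp add: continuous_on_cesaro bounded_by_one_T[OF bound] continuous_intros)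
    qed
    fix K :: "('g \<times> 'x) set" assume "compact K"
    let ?tv = "\<lambda>n (g, x). tv_norm (\<lambda>A. measure (distr (\<theta> n x) borel ((+) g)) A - measure (\<theta> n (actX g x)) A)"
    show "uniform_limit K ?tv (\<lambda>_. 0) sequentially"
    proof (rule uniform_limitI, rule ccontr)
      fix e :: real assume "0 < e"
      assume "\<not> (\<forall>\<^sub>F n in sequentially. \<forall>z\<in>K. dist (?tv n z) 0 < e)"
      then obtain N where N: "strict_mono (N :: nat \<Rightarrow> nat)" "\<And>n. \<exists>z\<in>K. \<not> dist (?tv (N n) z) 0 < e"
        using not_eventually_sequentiallyD by blast
      let ?d = "\<lambda>n g x F. (\<integral>h. F h \<partial>distr (\<theta> n x) borel ((+) g)) - (\<integral>h. F h \<partial>\<theta> n (actX g x))"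
      have "\<exists>g x F. (g, x) \<in> K \<and> bounded_by_one F \<and> e / 2 < \<bar>?d (N n) g x F\<bar>" for n
      proof (rule ccontr)
        assume none: "\<not> ?thesis"
        obtain g x where gx: "(g, x) \<in> K" "\<not> dist (?tv (N n) (g, x)) 0 < e" using N(2)[of n] by auto
        have "?tv (N n) (g, x) \<in> {0..e / 2}"
          using none gx(1) unfolding prod.case
          by (intro tv_norm_diff_bounds translate_prob \<theta>_prob) (metis not_less)
        then show False using gx(2) \<open>0 < e\<close> by auto
      qed
      then obtain g x F where gxF: "\<And>n. (g n, x n) \<in> K" "\<And>n. bounded_by_one (F n)"
          "\<And>n. e / 2 < \<bar>?d (N n) (g n) (x n) (F n)\<bar>" by metis
      obtain g' x' r where r: "strict_mono r" "((\<lambda>n. (g n, x n)) \<circ> r) \<longlonglongrightarrow> (g', x')"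
        using \<open>compact K\<close>[THEN compact_imp_seq_compact] gxF(1) unfolding seq_compact_def
        by (metis surj_pair)
      have lim: "(\<lambda>n. g (r n)) \<longlonglongrightarrow> g'" "(\<lambda>n. x (r n)) \<longlonglongrightarrow> x'"
        using tendsto_fst[OF r(2)] tendsto_snd[OF r(2)] by (simp_all add: o_def)
      have lim_act: "(\<lambda>n. act (g (r n)) (y n)) \<longlonglongrightarrow> act g' y'"
        if "continuous_action act" "y \<longlonglongrightarrow> y'" for act :: "'g \<Rightarrow> 'b::topological_space \<Rightarrow> 'b" and y y'
        using continuous_on_tendsto_compose[OF continuous_actionD(5)[OF that(1)] tendsto_Pair[OF lim(1) that(2)]]
        by simp
      let ?f = "\<lambda>n. T (F n)"
      obtain r' where r': "strict_mono r'"
        "(\<lambda>n. cesaro (N (r (r' n))) (actX (g (r (r' n))) (x (r (r' n)))) (?f (r (r' n))) (actS (g (r (r' n))) s0)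
            - cesaro (N (r (r' n))) (actX (g (r (r' n))) (x (r (r' n)))) (?f (r (r' n))) s0) \<longlonglongrightarrow> 0"
      proof (rule cesaro_asymptotically_constant[where N = "\<lambda>n. N (r n)" and f = "\<lambda>n. ?f (r n)"])
        show "(\<lambda>n. actX (g (r n)) (x (r n))) \<longlonglongrightarrow> actX g' x'" by (rule lim_act[OF actX lim(2)])
        show "(\<lambda>n. actS (g (r n)) s0) \<longlonglongrightarrow> actS g' s0" by (rule lim_act[OF actS(1) tendsto_const])
        show "filterlim (\<lambda>n. N (r n)) at_top sequentially"
          using strict_mono_o[OF N(1) r(1)] by (auto simp: o_def dest: filterlim_subseq)
      qed (use liouville bounded_by_one_T[OF gxF(2)] in auto)
      have ge: "e / 2 \<le> \<bar>cesaro (N n) (actX (g n) (x n)) (?f n) (actS (g n) s0)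
            - cesaro (N n) (actX (g n) (x n)) (?f n) s0\<bar>" for n
        using less_imp_le[OF gxF(3)[of n]] by (simp only: integral_translate integral_\<theta> gxF(2))
      have "e / 2 \<le> \<bar>0\<bar>"
        by (rule tendsto_lowerbound[OF tendsto_rabs[OF r'(2)]])
           (rule always_eventually, rule allI, rule ge, simp)
      then show False using \<open>0 < e\<close> by simp
    qed
  qed
qed

end

section \<open>Doob transforms by minimal harmonic functions\<close>

definition doob_transform :: "('s::topological_space \<Rightarrow> 's measure) \<Rightarrow> ('s \<Rightarrow> real) \<Rightarrow> 's \<Rightarrow> 's measure" where
  "doob_transform \<pi> u s = density (\<pi> s) (\<lambda>t. ennreal (u t / u s))"

locale positive_harmonic =
  fixes \<pi> :: "'s::{second_countable_topology, t2_space} \<Rightarrow> 's measure" and u :: "'s \<Rightarrow> real"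
  assumes \<pi>: "\<pi> \<in> borel \<rightarrow>\<^sub>M prob_algebra borel"
    and harmonic: "harmonic \<pi> u" and pos: "\<And>s. 0 < u s"
begin

lemma sets_\<pi> [simp, measurable_cong]: "sets (\<pi> s) = sets borel"
  using measurable_space[OF \<pi>, of s] by (simp add: space_prob_algebra)

lemma space_\<pi> [simp]: "space (\<pi> s) = UNIV"
  using sets_eq_imp_space_eq[OF sets_\<pi>] by simp

lemma u_measurable [measurable]: "u \<in> borel_measurable borel"
  using harmonic by (simp add: harmonic_def)

lemma nn_integral_doob_density: "(\<integral>\<^sup>+t. ennreal (u t / u s) \<partial>\<pi> s) = 1"
proof -
  have int: "integrable (\<pi> s) u" and eq: "(\<integral>t. u t \<partial>\<pi> s) = u s"
    using harmonic by (auto simp: harmonic_def markov_operator_def fun_eq_iff)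
  have "(\<integral>\<^sup>+t. ennreal (u t / u s) \<partial>\<pi> s) = ennreal (\<integral>t. u t / u s \<partial>\<pi> s)"
    using int pos by (intro nn_integral_eq_integral) (auto simp: less_imp_le)
  also have "\<dots> = 1" using eq pos[of s] by simp
  finally show ?thesis .
qed

lemma doob_transform_measurable: "doob_transform \<pi> u \<in> borel \<rightarrow>\<^sub>M prob_algebra borel"
proof (rule measurable_prob_algebra_generated[where G = "sets borel" and \<Omega> = UNIV])
  show "sets borel = sigma_sets UNIV (sets (borel :: 's measure))"
    using sets.sigma_sets_eq[of "borel :: 's measure"] by simp
  show "sets (doob_transform \<pi> u s) = sets borel" for s by (simp add: doob_transform_def)
  show "prob_space (doob_transform \<pi> u s)" for s
    using nn_integral_doob_density[of s]
    by (intro prob_spaceI) (simp add: doob_transform_def emeasure_density)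
  show "(\<lambda>s. emeasure (doob_transform \<pi> u s) A) \<in> borel_measurable borel"
    if [measurable]: "A \<in> sets borel" for A
  proof -
    have "(\<lambda>s. \<integral>\<^sup>+t. ennreal (u t / u s) * indicator A t \<partial>\<pi> s) \<in> borel_measurable borel"
      by (rule nn_integral_measurable_subprob_algebra2[OF _ measurable_prob_algebraD[OF \<pi>]]) measurable
    then show ?thesis by (simp add: doob_transform_def emeasure_density)
  qed
qed (auto intro: sets.Int_stable)

lemma markov_operator_doob_transform:
  assumes [measurable]: "f \<in> borel_measurable borel"
  shows "markov_operator (doob_transform \<pi> u) f s = (\<integral>t. u t * f t \<partial>\<pi> s) / u s"
  unfolding markov_operator_def doob_transform_def
  by (subst integral_density) (use pos in \<open>auto simp: less_imp_le\<close>)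

text \<open>
  The function \<open>u * (1 + h) / 2\<close> is harmonic for \<open>\<pi>\<close> and lies between \<open>0\<close> and \<open>u\<close>, so by minimality
  it is a multiple of \<open>u\<close>.
\<close>

lemma minimal_imp_liouville:
  assumes minimal: "minimal_positive_harmonic \<pi> u"
    and h: "bounded_by_one h" and Ph: "markov_operator (doob_transform \<pi> u) h = h"
  shows "\<exists>c. \<forall>s. h s = c"
proof -
  have [measurable]: "h \<in> borel_measurable borel" using h by (rule bounded_by_oneD)
  have int_u: "integrable (\<pi> s) u" and int_u_eq: "(\<integral>t. u t \<partial>\<pi> s) = u s" for s
    using harmonic by (auto simp: harmonic_def markov_operator_def fun_eq_iff)
  have int_uh: "integrable (\<pi> s) (\<lambda>t. u t * h t)" for s
    by (rule Bochner_Integration.integrable_bound[OF int_u])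
       (use bounded_by_oneD(2)[OF h] in \<open>auto simp: abs_mult mult_left_le\<close>)
  have int_uh_eq: "(\<integral>t. u t * h t \<partial>\<pi> s) = u s * h s" for s
    using markov_operator_doob_transform[of h s] fun_cong[OF Ph, of s] pos[of s]
    by (simp add: field_simps)
  \<comment> \<open>Shifting \<open>h\<close> by \<open>1\<close> makes it nonnegative; minimality speaks of nonnegative functions only.\<close>
  define \<psi> where "\<psi> t = (u t + u t * h t) / 2" for t
  have "harmonic \<pi> \<psi>"
    unfolding harmonic_def markov_operator_def fun_eq_iff \<psi>_def[abs_def]
    by (simp add: int_u int_uh int_u_eq int_uh_eq)
  moreover have "0 \<le> \<psi> s \<and> \<psi> s \<le> u s" for s
  proof -
    have "\<psi> s = u s * ((1 + h s) / 2)" by (simp add: \<psi>_def field_simps)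
    moreover have "0 \<le> u s * ((1 + h s) / 2)" "u s * ((1 + h s) / 2) \<le> u s"
      using bounded_by_oneD(3,4)[OF h, where t = s] pos[of s]
      by (auto intro: mult_nonneg_nonneg mult_left_le)
    ultimately show ?thesis by (simp only:)
  qed
  ultimately obtain c where c: "\<And>s. \<psi> s = c * u s"
    using minimal unfolding minimal_positive_harmonic_def by blast
  have "h s = 2 * c - 1" for s
  proof -
    have "u s * (1 + h s) = u s * (2 * c)"
      using c[of s] by (simp add: \<psi>_def field_simps)
    then have "1 + h s = 2 * c" using pos[of s] by simp
    then show ?thesis by simp
  qed
  then show ?thesis by blast
qed

end

text \<open>
  The transformed kernel has the density \<open>p s t * (\<phi> x t / \<phi> x s)\<close>, which is jointly continuous in
  \<open>x\<close> and \<open>s\<close> for each \<open>t\<close> and integrates to one because \<open>\<phi> x\<close> is harmonic.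
\<close>

lemma norm_continuous_kernels_doob_transform:
  fixes \<phi> :: "'x::{second_countable_topology, t2_space} \<Rightarrow>
                's::{second_countable_topology, t2_space} \<Rightarrow> real"
  assumes m: "sets m = sets borel"
    and p: "continuous_on UNIV (\<lambda>(s, t). p s t)" "\<And>s t. 0 \<le> p s t"
    and density: "\<And>s. \<pi> s = density m (\<lambda>t. ennreal (p s t))"
    and harmonic: "\<And>x. positive_harmonic \<pi> (\<phi> x)"
    and cont: "projectively_continuous \<phi>"
  shows "norm_continuous_kernels (\<lambda>x. doob_transform \<pi> (\<phi> x))"
proof
  fix X and x :: 'x and S and s :: 's and f :: "nat \<Rightarrow> 's \<Rightarrow> real"
  note pos = positive_harmonic.pos[OF harmonic]
  note doob_transform_measurable = positive_harmonic.doob_transform_measurable[OF harmonic]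
  show "doob_transform \<pi> (\<phi> x) \<in> borel \<rightarrow>\<^sub>M prob_algebra borel" for x
    by (rule doob_transform_measurable)
  assume X: "X \<longlonglongrightarrow> x" and S: "S \<longlonglongrightarrow> s" and f: "\<And>n. bounded_by_one (f n)"
  define q where "q x s t = p s t * (\<phi> x t / \<phi> x s)" for x s t
  have "continuous_on UNIV (p s)" for s
    using continuous_on_compose2[OF p(1), of UNIV "\<lambda>t. (s, t)"]
    by (simp add: continuous_on_Pair continuous_on_const continuous_on_id)
  then have p_measurable: "p s \<in> borel_measurable m" for s
    by (subst measurable_cong_sets[OF m refl]) (rule borel_measurable_continuous_onI)
  have \<phi>_measurable: "\<phi> x \<in> borel_measurable m" for x
    by (subst measurable_cong_sets[OF m refl]) (rule positive_harmonic.u_measurable[OF harmonic])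
  have q_measurable: "q x s \<in> borel_measurable m" for x s
    unfolding q_def
    by (intro borel_measurable_times borel_measurable_divide borel_measurable_const
        p_measurable \<phi>_measurable)
  have q_nonneg: "0 \<le> q x s t" for x s t
    unfolding q_def by (intro mult_nonneg_nonneg divide_nonneg_nonneg p(2) less_imp_le[OF pos])
  have kernel_eq: "doob_transform \<pi> (\<phi> x) s = density m (\<lambda>t. ennreal (q x s t))" for x s
  proof -
    have ratio: "(\<lambda>t. \<phi> x t / \<phi> x s) \<in> borel_measurable m"
      by (intro borel_measurable_divide borel_measurable_const \<phi>_measurable)
    have "doob_transform \<pi> (\<phi> x) s
        = density m (\<lambda>t. ennreal (p s t) * ennreal (\<phi> x t / \<phi> x s))"
      unfolding doob_transform_def density
      by (rule density_density_eq) (rule measurable_compose[OF _ measurable_ennreal], rule p_measurable ratio)+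
    also have "(\<lambda>t. ennreal (p s t) * ennreal (\<phi> x t / \<phi> x s)) = (\<lambda>t. ennreal (q x s t))"
      unfolding q_def by (rule ext, rule ennreal_mult'[symmetric], rule p(2))
    finally show ?thesis .
  qed
  have q_prob: "(\<integral>\<^sup>+t. ennreal (q x s t) \<partial>m) = 1" for x s
  proof -
    have "prob_space (doob_transform \<pi> (\<phi> x) s)"
      using measurable_space[OF doob_transform_measurable, of s x]
      by (simp add: space_prob_algebra)
    then have "emeasure (density m (\<lambda>t. ennreal (q x s t))) (space m) = 1"
      unfolding kernel_eq using prob_space.emeasure_space_1 by fastforce
    then have "(\<integral>\<^sup>+t. ennreal (q x s t) * indicator (space m) t \<partial>m) = 1"
      by (subst (asm) emeasure_density)
         (rule measurable_compose[OF q_measurable measurable_ennreal], rule sets.top)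
    moreover have "(\<integral>\<^sup>+t. ennreal (q x s t) * indicator (space m) t \<partial>m) = (\<integral>\<^sup>+t. ennreal (q x s t) \<partial>m)"
      by (rule nn_integral_cong) (simp only: indicator_simps mult_1_right)
    ultimately show ?thesis by (simp only:)
  qed
  have lim: "(\<lambda>n. q (X n) (S n) t) \<longlonglongrightarrow> q x s t" for t
  proof -
    have "(\<lambda>n. p (S n) t) \<longlonglongrightarrow> p s t"
      using continuous_on_tendsto_compose[OF p(1) tendsto_Pair[OF S tendsto_const]] by simp
    moreover have "(\<lambda>n. \<phi> (X n) t / \<phi> (X n) (S n)) \<longlonglongrightarrow> \<phi> x t / \<phi> x s"
      using continuous_on_tendsto_compose[OF cont[unfolded projectively_continuous_def]
          tendsto_Pair[OF X tendsto_Pair[OF S tendsto_const]]] by simp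
    ultimately show ?thesis unfolding q_def by (rule tendsto_mult)
  qed
  have "f n \<in> borel_measurable m" for n
    using bounded_by_oneD(1)[OF f] by (subst measurable_cong_sets[OF m refl])
  then show "(\<lambda>n. markov_operator (doob_transform \<pi> (\<phi> (X n))) (f n) (S n)
      - markov_operator (doob_transform \<pi> (\<phi> x)) (f n) s) \<longlonglongrightarrow> 0"
    unfolding markov_operator_def kernel_eq
    by (intro densities_converge_in_norm q_measurable q_nonneg q_prob lim bounded_by_oneD(2)[OF f])
qed

text \<open>
  The constant relating \<open>\<phi> (actX g x)\<close> to the translate of \<open>\<phi> x\<close> cancels in the ratio.
\<close>

lemma doob_transform_equivariant:
  assumes act: "continuous_action actS"
    and invariant: "invariant_kernel actS \<pi>"
    and harmonic: "\<And>x. positive_harmonic \<pi> (\<phi> x)"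
    and equivariant: "projectively_equivariant actS actX \<phi>"
  shows "doob_transform \<pi> (\<phi> (actX g x)) (actS g s) = distr (doob_transform \<pi> (\<phi> x) s) borel (actS g)"
proof -
  obtain c where c: "\<And>t. \<phi> (actX g x) t = c * \<phi> x (actS (- g) t)"
    using equivariant unfolding projectively_equivariant_def by blast
  then have "c \<noteq> 0" using positive_harmonic.pos[OF harmonic, of "actX g x" s] by auto
  then have ratio: "\<phi> (actX g x) (actS g t) / \<phi> (actX g x) (actS g s) = \<phi> x t / \<phi> x s" for t
    by (simp add: c continuous_actionD[OF act])
  have act_measurable: "actS g \<in> borel_measurable borel"
    by (intro borel_measurable_continuous_onI continuous_on_action[OF act] continuous_intros)
  have act_\<pi>: "\<pi> (actS g s) = distr (\<pi> s) borel (actS g)"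
    using invariant by (simp add: invariant_kernel_def)
  have "density (distr (\<pi> s) borel (actS g)) (\<lambda>t. ennreal (\<phi> (actX g x) t / \<phi> (actX g x) (actS g s)))
      = distr (density (\<pi> s) (\<lambda>t. ennreal (\<phi> (actX g x) (actS g t) / \<phi> (actX g x) (actS g s)))) borel (actS g)"
  proof (rule density_distr)
    show "(\<lambda>t. ennreal (\<phi> (actX g x) t / \<phi> (actX g x) (actS g s))) \<in> borel_measurable borel"
      by (rule measurable_compose[OF borel_measurable_divide[OF positive_harmonic.u_measurable[OF harmonic] borel_measurable_const] measurable_ennreal])
    show "actS g \<in> borel_measurable (\<pi> s)"
      by (subst measurable_cong_sets[OF positive_harmonic.sets_\<pi>[OF harmonic] refl]) (rule act_measurable)
  qed
  then show ?thesis by (simp only: doob_transform_def act_\<pi> ratio)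
qed

theorem theorem6p3:
  fixes actS :: "'g::{topological_group_add, second_countable_topology, t2_space} \<Rightarrow>
                   's::{second_countable_topology, t2_space} \<Rightarrow> 's"
    and actX :: "'g \<Rightarrow> 'x::{second_countable_topology, t2_space} \<Rightarrow> 'x"
    and m :: "'s measure"
    and \<pi> :: "'s \<Rightarrow> 's measure"
    and p :: "'s \<Rightarrow> 's \<Rightarrow> real"
    and \<phi> :: "'x \<Rightarrow> 's \<Rightarrow> real"
  assumes "locally_compact_space (euclidean :: 'g topology)"
    and "locally_compact_space (euclidean :: 's topology)"
    and "locally_compact_space (euclidean :: 'x topology)"
    and "continuous_action actS" and "proper_action actS"
    and "continuous_action actX"
    and "sets m = sets borel" and "invariant_measure actS m"
    and "\<pi> \<in> borel \<rightarrow>\<^sub>M prob_algebra borel" and "invariant_kernel actS \<pi>"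
    and "continuous_on UNIV (\<lambda>(s, t). p s t)" and "\<And>s t. 0 \<le> p s t"
    and "\<And>s. \<pi> s = density m (\<lambda>t. ennreal (p s t))"
    and "\<And>x. minimal_positive_harmonic \<pi> (\<phi> x)"
    and "projectively_continuous \<phi>"
    and "projectively_equivariant actS actX \<phi>"
  shows "topologically_amenable actX"
proof -
  have harmonic: "positive_harmonic \<pi> (\<phi> x)" for x
    using assms(9,14) by (auto simp: positive_harmonic_def minimal_positive_harmonic_def)
  interpret norm_continuous_kernels "\<lambda>x. doob_transform \<pi> (\<phi> x)"
    by (rule norm_continuous_kernels_doob_transform[OF assms(7,11-13) harmonic assms(15)])
  show ?thesis
  proof (rule topologically_amenable_if_liouville[OF assms(1,2,4-6)])
    show "doob_transform \<pi> (\<phi> (actX g x)) (actS g s)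
        = distr (doob_transform \<pi> (\<phi> x) s) borel (actS g)" for g x s
      by (rule doob_transform_equivariant[OF assms(4,10) harmonic assms(16)])
    show "\<exists>c. \<forall>s. h s = c"
      if "bounded_by_one h" "markov_operator (doob_transform \<pi> (\<phi> x)) h = h" for x h
      by (rule positive_harmonic.minimal_imp_liouville[OF harmonic assms(14) that])
  qed
qed

end
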